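(* The discrete Heisenberg group $\mathsf{H}_3(\mathbb{Z})$ admits a non-empty strongly aperiodic shift of finite type $\Omega$ together with a factor map $\phi:\Omega\to\phi(\Omega)$ onto a subshift $\phi(\Omega)$ (over some finite alphabet) such that: (i) $\phi(\Omega)$ is strongly aperiodic and minimal (and hence is a strongly aperiodic, minimal sofic $\mathsf{H}_3(\mathbb{Z})$-shift); (ii) $\phi$ is at most two-to-one, i.e. every configuration in $\phi(\Omega)$ has at most two preimages under $\phi$; (iii) $\phi$ is one-to-one on a dense set of configurations, i.e. there is a dense subset $D\subseteq\phi(\Omega)$ such that every $\omega\in D$ has exactly one preimage.
   Context: The discrete Heisenberg group $\mathsf{H}_3(\mathbb{Z})$ is the group of $3\times 3$ upper-triangular unipotent integer matrices $\begin{pmatrix}1&x&z\\0&1&y\\0&0&1\end{pmatrix}$, $x,y,z\in\mathbb{Z}$, under matrix multiplication; equivalently the semidirect product $\mathbb{Z}^2\rtimes_A\mathbb{Z}$ with $A=\begin{pmatrix}1&0\\1&1\end{pmatrix}$, with operation $(x,(y,z))\cdot(a,(b,c))=(x+a,(y+b,z+c+xb))$. For a finitely generated group $G$ and finite alphabet $\mathcal{A}$, the full shift is $\mathcal{A}^G$ with the prodiscrete (product) topology and the right shift action $(\sigma^g\omega)_h=\omega_{hg}$. A subshift is a non-empty closed shift-invariant subset $\Omega\subseteq\mathcal{A}^G$. A pattern is a map $p:F\to\mathcal{A}$ with $F\subseteq G$ finite; $p$ occurs in $\omega$ if $\omega|_{Fg}$ equals $p$ translated, for some $g\in G$. A shift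 of finite type (SFT) is a set of the form $\{\omega\in\mathcal{A}^G: \text{no } p\in\mathcal{F}\text{ occurs in }\omega\}$ for a finite set $\mathcal{F}$ of patterns. A factor map between subshifts is a continuous surjective map commuting with the shift actions; a sofic shift is a factor of an SFT. The stabilizer of $\omega$ is $\mathrm{Stab}(\omega)=\{g\in G:\sigma^g\omega=\omega\}$; a subshift is strongly aperiodic if every configuration in it has trivial stabilizer. A subshift is minimal if it contains no non-empty proper closed shift-invariant subset (equivalently, every orbit is dense). *)

theory Defs
  imports "HOL-Analysis.Analysis"
begin

text \<open>The discrete Heisenberg group H3(Z), as Z^2 x_A Z: elements (x,y,z) with
 (x,y,z)*(a,b,c) = (x+a, y+b, z+c+x*b) (upper unitriangular matrices).\<close>

type_synonym heis = "int \<times> int \<times> int"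

definition hmul :: "heis \<Rightarrow> heis \<Rightarrow> heis" where
  "hmul g h = (case g of (x,y,z) \<Rightarrow> case h of (a,b,c) \<Rightarrow> (x+a, y+b, z+c+x*b))"

definition hone :: heis where "hone = (0,0,0)"

text \<open>Configurations: maps heis => nat; a finite alphabet is a finite set A of naturals.
 The topology on configurations is the product topology (library instance on function
 types), nat carrying its discrete topology; this is the prodiscrete topology.\<close>

type_synonym config = "heis \<Rightarrow> nat"

definition full_shift :: "nat set \<Rightarrow> config set" where
  "full_shift A = {\<omega>. \<forall>g. \<omega> g \<in> A}"

definition shift :: "heis \<Rightarrow> config \<Rightarrow> config" where
  "shift g \<omega> = (\<lambda>h. \<omega> (hmul h g))"

definition shift_invariant :: "config set \<Rightarrow> bool" where
  "shift_invariant X \<longleftrightarrow> (\<forall>g. \<forall>\<omega>\<in>X. shift g \<omega> \<in> X)"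

definition subshift :: "nat set \<Rightarrow> config set \<Rightarrow> bool" where
  "subshift A X \<longleftrightarrow> finite A \<and> X \<noteq> {} \<and> X \<subseteq> full_shift A \<and> closed X \<and> shift_invariant X"

definition occurs :: "heis set \<times> (heis \<Rightarrow> nat) \<Rightarrow> config \<Rightarrow> bool" where
  "occurs P \<omega> \<longleftrightarrow> (\<exists>g. \<forall>h\<in>fst P. \<omega> (hmul h g) = snd P h)"

definition is_SFT :: "nat set \<Rightarrow> config set \<Rightarrow> bool" where
  "is_SFT A X \<longleftrightarrow> finite A \<and> (\<exists>\<F>. finite \<F> \<and> (\<forall>P\<in>\<F>. finite (fst P)) \<and>
      X = {\<omega> \<in> full_shift A. \<forall>P\<in>\<F>. \<not> occurs P \<omega>})"

definition stab :: "config \<Rightarrow> heis set" where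
  "stab \<omega> = {g. shift g \<omega> = \<omega>}"

definition strongly_aperiodic :: "config set \<Rightarrow> bool" where
  "strongly_aperiodic X \<longleftrightarrow> (\<forall>\<omega>\<in>X. stab \<omega> = {hone})"

definition minimal_subshift :: "nat set \<Rightarrow> config set \<Rightarrow> bool" where
  "minimal_subshift A X \<longleftrightarrow> subshift A X \<and>
     (\<forall>Y. Y \<subseteq> X \<and> Y \<noteq> {} \<and> closed Y \<and> shift_invariant Y \<longrightarrow> Y = X)"

definition factor_map :: "config set \<Rightarrow> (config \<Rightarrow> config) \<Rightarrow> bool" where
  "factor_map X \<phi> \<longleftrightarrow> continuous_on X \<phi> \<and> (\<forall>g. \<forall>\<omega>\<in>X. \<phi> (shift g \<omega>) = shift g (\<phi> \<omega>))"

end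

theory Submission
  imports Defs "HOL-Computational_Algebra.Factorial_Ring" "Berlekamp_Zassenhaus.Finite_Field"
begin

text \<open>
  The factor map is the identity: there is a minimal strongly aperiodic shift of finite type.

  The group is identified with the incidences between the points of the integer plane and the lines of
  integer slope. Fix two primes \<open>p\<close> and \<open>q\<close>. A configuration carries a \<open>p\<close>-adic hierarchy on the
  points and an independent \<open>q\<close>-adic hierarchy on the lines: a point label is the leading digit in
  \<open>F\<^sub>p\<^sup>2\<close> of its displacement from a \<open>p\<close>-adic centre, and dually for lines. Labels are transported
  along whole pencils and lines by local rules. Along a line of level \<open>n\<close> a signal passes through the
  points of smaller level and forces the remaining point labels to form an arithmetic progression;
  again dually for points.

  Since every pair of points in adjacent columns is joined by a line, a counting argument modulo \<open>p\<close>
  shows that these rules force the first level of both hierarchies. The elements of positive level form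
  a coset of the subgroup \<open>(q x, p y, p q z)\<close>, which is isomorphic to the whole group, and the
  configuration restricts there to a configuration obeying the same rules. Iterating, a period lies in
  all these subgroups up to conjugation and is trivial, and every finite pattern is determined by its
  position in the hierarchy together with one tile of a higher level. As all admissible tiles occur on
  the first two levels of every configuration, the shift is minimal.
\<close>


text \<open>Labels are single digits, so no local rule can mention a level. Instead the signals
  count: on a line of level \<open>n\<close> that meets points of level at least \<open>n\<close>,
  these occur at spacing \<open>p^n\<close>; the signal advances by one there and passes all other
  points unchanged. A line that meets no such point has nothing to count and carries the blank label
  0. Blanks switch the counting rule off, and their unknown positions in an arbitrary configuration
  are the obstacle to rigidity: they are shown to be so sparse that each kind excludes at most one
  candidate in a short window. On the residue class of the centre the rules leave the labels open,
  and this freedom is the next level. Coprimality of the characteristics makes the two hierarchies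
  independent: it aligns the two centres, realizes every pair of residues, and makes
  \<open>q\<close> a unit modulo \<open>p\<close>, as rescaling requires. The bound 11 pays for
  windows of eight candidates against seven bad conditions, and for the estimate 8 + 2 < 11 on
  differences of heights in the smallest box.\<close>

class large_prime_field = finite + field +
  assumes ex_of_int: "\<exists>k. x = of_int k"
    and CHAR_large: "11 \<le> CHAR('a)"

section \<open>Residues modulo a large characteristic, and choice by counting\<close>

lemma of_int_eq_iff_CHAR_dvd:
  "(of_int k = (of_int l :: 'a::ring_1)) \<longleftrightarrow> int CHAR('a) dvd k - l"
  using of_int_eq_0_iff_char_dvd[of "k - l", where ?'a='a] by simp

lemma of_int_inj_on_window:
  assumes "(of_int k :: 'a::ring_1) = of_int l" "\<bar>k - l\<bar> < int CHAR('a)"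
  shows "k = l"
  using assms dvd_imp_le_int[of "k - l" "int CHAR('a)"] by (force simp: of_int_eq_iff_CHAR_dvd)

text \<open>Each predicate removes at most one element of \<open>W\<close>. Genericity arguments
  below take this form: the list collects the degenerate situations, each of which is met at most
  once in the window.\<close>

lemma ex_avoiding_all:
  assumes "finite W" "length Ps < card W"
    and "\<And>P x y. P \<in> set Ps \<Longrightarrow> x \<in> W \<Longrightarrow> y \<in> W \<Longrightarrow> P x \<Longrightarrow> P y \<Longrightarrow> x = y"
  shows "\<exists>x\<in>W. \<forall>P\<in>set Ps. \<not> P x"
  using assms
proof (induction Ps arbitrary: W)
  case Nil
  then show ?case by (auto simp: card_gt_0_iff)
next
  case (Cons P Ps)
  define V where "V = {x\<in>W. \<not> P x}"
  have "card {x\<in>W. P x} \<le> Suc 0"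
    unfolding card_le_Suc0_iff_eq[OF finite_subset[OF _ Cons.prems(1), of "{x\<in>W. P x}", OF Collect_subset]]
    using Cons.prems(3)[of P] by auto
  moreover have "card W = card V + card {x\<in>W. P x}"
  proof -
    have "W = V \<union> {x\<in>W. P x}" by (auto simp: V_def)
    then show ?thesis
      using card_Un_disjoint[of V "{x\<in>W. P x}"] Cons.prems(1) by (auto simp: V_def)
  qed
  ultimately have "length Ps < card V" using Cons.prems(2) by simp
  moreover have "finite V" using Cons.prems(1) by (simp add: V_def)
  ultimately have "\<exists>x\<in>V. \<forall>P\<in>set Ps. \<not> P x"
    using Cons.IH[of V] Cons.prems(3) by (auto simp: V_def)
  then show ?case by (auto simp: V_def)
qed

lemma ex_int_avoiding_all:
  assumes "int (length Ps) < n"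
    and "\<And>P x y. P \<in> set Ps \<Longrightarrow> x \<in> {0..<n} \<Longrightarrow> y \<in> {0..<n} \<Longrightarrow> P x \<Longrightarrow> P y \<Longrightarrow> x = y"
  shows "\<exists>x\<in>{0..<n}. \<forall>P\<in>set Ps. \<not> P x"
  by (rule ex_avoiding_all) (use assms in auto)

text \<open>
  An element \<open>(x,y,z)\<close> is read as the incidence of the point \<open>(y, z - x*y)\<close>, which is constant along
  the \<open>X\<close>-line \<open>(x+k, y, z+k*y)\<close>, with the line \<open>(x,z)\<close>, which is constant along the \<open>Y\<close>-line
  \<open>(x, y+k, z)\<close>. The status compares the \<open>p\<close>-adic level of the point with the \<open>q\<close>-adic level of the
  line. \<open>ptl\<close> and \<open>lnl\<close> are the leading digits of point and line (\<open>0\<close> on the lines along which no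
  comparison is made); \<open>row\<close> and \<open>pen\<close> are the values that the next point on the \<open>Y\<close>-line, respectively
  the next line on the \<open>X\<close>-line, whose level is high enough must have.
\<close>

datatype status = Same | PointDeep | LineDeep

datatype ('a, 'b) tile =
  Tile (st: status) (ptl: "'a \<times> 'a") (lnl: "'b \<times> 'b") (row: "'a \<times> 'a") (pen: "'b \<times> 'b")

text \<open>A step along an \<open>X\<close>-line changes \<open>(y, z)\<close> into
  \<open>(y, z + y)\<close>, hence the shear of point labels. Meanwhile \<open>x*y - z\<close> stays
  constant, so the next line to be compared differs only in the first digit, hence
  \<open>inc\<close>. The same holds dually.\<close>

definition sh :: "'a::plus \<times> 'a \<Rightarrow> 'a \<times> 'a" where "sh v = (fst v, snd v + fst v)"
definition inc :: "'a::{plus,one} \<times> 'a \<Rightarrow> 'a \<times> 'a" where "inc v = (fst v + 1, snd v)"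

lemma sh_sel[simp]: "fst (sh v) = fst v" "snd (sh v) = snd v + fst v" by (auto simp: sh_def)
lemma inc_sel[simp]: "fst (inc v) = fst v + 1" "snd (inc v) = snd v" by (auto simp: inc_def)
lemma sh_eq_0[simp]: "sh v = 0 \<longleftrightarrow> v = (0 :: 'a::ab_group_add \<times> 'a)" by (auto simp: prod_eq_iff)

text \<open>\<open>Same\<close> ties the signals to the labels. At a deeper point the digit at the
  level of the line is 0, hence \<open>row T = 0\<close>. If \<open>ptl T\<close> is not blank
  there, some line of the pencil reaches the level of the point; this makes \<open>x*y - z\<close>
  divisible beyond the level of the present line, hence \<open>snd (lnl T) = 0\<close>.\<close>

definition ok_tile :: "('a::field, 'b::field) tile \<Rightarrow> bool" where
  "ok_tile T = (case st T of
     Same \<Rightarrow> ptl T \<noteq> 0 \<and> lnl T \<noteq> 0 \<and> row T = ptl T \<and> pen T = lnl T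
   | PointDeep \<Rightarrow> row T = 0 \<and> lnl T \<noteq> 0 \<and>
       (ptl T = 0 \<and> pen T = 0 \<or> ptl T \<noteq> 0 \<and> snd (lnl T) = 0)
   | LineDeep \<Rightarrow> pen T = 0 \<and> ptl T \<noteq> 0 \<and>
       (lnl T = 0 \<and> row T = 0 \<or> lnl T \<noteq> 0 \<and> snd (ptl T) = 0))"

definition ok_X :: "('a::field, 'b::field) tile \<Rightarrow> ('a, 'b) tile \<Rightarrow> bool" where
  "ok_X S T \<longleftrightarrow> ptl T = sh (ptl S) \<and> pen T = (if st S = PointDeep then pen S else inc (pen S))"

definition ok_Y :: "('a::field, 'b::field) tile \<Rightarrow> ('a, 'b) tile \<Rightarrow> bool" where
  "ok_Y S T \<longleftrightarrow> lnl T = sh (lnl S) \<and> row T = (if st S = LineDeep then row S else inc (row S))"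

text \<open>Neighbours are taken by left multiplication, which commutes with the right translations
  of the shift action.\<close>

definition valid :: "(heis \<Rightarrow> ('a::field, 'b::field) tile) \<Rightarrow> bool" where
  "valid w \<longleftrightarrow> (\<forall>g. ok_tile (w g) \<and> ok_X (w g) (w (hmul (1,0,0) g)) \<and> ok_Y (w g) (w (hmul (0,1,0) g)))"

lemma hmul_simp[simp]: "hmul (x,y,z) (a,b,c) = (x+a, y+b, z+c+x*b)" by (simp add: hmul_def)

lemma hmul_assoc: "hmul (hmul f g) h = hmul f (hmul g h)"
  by (cases f; cases g; cases h) (simp add: algebra_simps)

lemma valid_tile: "valid w \<Longrightarrow> ok_tile (w g)" unfolding valid_def by blast

lemma valid_X:
  assumes "valid w"
  shows "ptl (w (x+1,y,z+y)) = sh (ptl (w (x,y,z)))"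
    and "pen (w (x+1,y,z+y)) = (if st (w (x,y,z)) = PointDeep then pen (w (x,y,z)) else inc (pen (w (x,y,z))))"
  using assms unfolding valid_def ok_X_def
  by (auto simp: add.commute simp del: split_paired_All dest!: spec[of _ "(x,y,z)"])

lemma valid_Y:
  assumes "valid w"
  shows "lnl (w (x,y+1,z)) = sh (lnl (w (x,y,z)))"
    and "row (w (x,y+1,z)) = (if st (w (x,y,z)) = LineDeep then row (w (x,y,z)) else inc (row (w (x,y,z))))"
  using assms unfolding valid_def ok_Y_def
  by (auto simp: add.commute simp del: split_paired_All dest!: spec[of _ "(x,y,z)"])

lemma valid_shift:
  assumes "valid w"
  shows "valid (\<lambda>h. w (hmul h g))"
  using assms unfolding valid_def hmul_assoc by blast

lemma tile_Same:
  assumes "valid w" "st (w g) = Same"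
  shows "ptl (w g) \<noteq> 0" "lnl (w g) \<noteq> 0" "row (w g) = ptl (w g)" "pen (w g) = lnl (w g)"
  using valid_tile[OF assms(1), of g] assms(2) by (auto simp: ok_tile_def)

lemma tile_PointDeep:
  assumes "valid w" "st (w g) = PointDeep"
  shows "row (w g) = 0" "lnl (w g) \<noteq> 0" "ptl (w g) = 0 \<Longrightarrow> pen (w g) = 0"
    "ptl (w g) \<noteq> 0 \<Longrightarrow> snd (lnl (w g)) = 0"
  using valid_tile[OF assms(1), of g] assms(2) by (auto simp: ok_tile_def)

lemma tile_LineDeep:
  assumes "valid w" "st (w g) = LineDeep"
  shows "pen (w g) = 0" "ptl (w g) \<noteq> 0" "lnl (w g) = 0 \<Longrightarrow> row (w g) = 0"
    "lnl (w g) \<noteq> 0 \<Longrightarrow> snd (ptl (w g)) = 0"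
  using valid_tile[OF assms(1), of g] assms(2) by (auto simp: ok_tile_def)

lemma status_cases:
  obtains "st T = Same" | "st T = PointDeep" | "st T = LineDeep"
  by (cases "st T") auto

section \<open>Duality between points and lines\<close>

fun flip :: "status \<Rightarrow> status" where
  "flip Same = Same" | "flip PointDeep = LineDeep" | "flip LineDeep = PointDeep"

definition swap_tile :: "('a, 'b) tile \<Rightarrow> ('b, 'a) tile" where
  "swap_tile T = Tile (flip (st T)) (lnl T) (ptl T) (pen T) (row T)"

text \<open>The involutive automorphism exchanging the generators \<open>X\<close> and
  \<open>Y\<close>. It turns the line coordinates \<open>(x, x*y - z)\<close> into point
  coordinates, so each result on points yields one on lines.\<close>

definition dual :: "heis \<Rightarrow> heis" where
  "dual g = (case g of (x,y,z) \<Rightarrow> (y, x, x*y - z))"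

definition dual_conf :: "(heis \<Rightarrow> ('a, 'b) tile) \<Rightarrow> heis \<Rightarrow> ('b, 'a) tile" where
  "dual_conf w = (\<lambda>g. swap_tile (w (dual g)))"

lemma dual_simp[simp]: "dual (x,y,z) = (y,x,x*y-z)" by (simp add: dual_def)

lemma dual_dual[simp]: "dual (dual g) = g" by (cases g) simp

lemma flip_eq[simp]: "flip s = PointDeep \<longleftrightarrow> s = LineDeep" "flip s = LineDeep \<longleftrightarrow> s = PointDeep"
  "flip s = Same \<longleftrightarrow> s = Same"
  by (cases s; simp)+

lemma swap_tile_sel[simp]: "st (swap_tile T) = flip (st T)" "ptl (swap_tile T) = lnl T"
  "lnl (swap_tile T) = ptl T" "row (swap_tile T) = pen T" "pen (swap_tile T) = row T"
  by (auto simp: swap_tile_def)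

lemma swap_swap[simp]: "swap_tile (swap_tile T) = T"
  by (cases T; cases "st T") (auto simp: swap_tile_def)

lemma ok_tile_swap: "ok_tile (swap_tile T) \<longleftrightarrow> ok_tile T"
  by (cases "st T") (auto simp: ok_tile_def)

lemma valid_dual:
  assumes "valid w"
  shows "valid (dual_conf w)"
  unfolding valid_def dual_conf_def
proof (intro allI conjI)
  fix g :: heis
  obtain x y z where g: "g = (x,y,z)" by (cases g) auto
  show "ok_tile (swap_tile (w (dual g)))" using valid_tile[OF assms] by (simp add: ok_tile_swap)
  show "ok_X (swap_tile (w (dual g))) (swap_tile (w (dual (hmul (1,0,0) g))))"
    using valid_Y[OF assms, of y x "x*y-z"] by (simp add: g ok_X_def algebra_simps)
  show "ok_Y (swap_tile (w (dual g))) (swap_tile (w (dual (hmul (0,1,0) g))))"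
    using valid_X[OF assms, of y x "x*y-z"] by (simp add: g ok_Y_def algebra_simps)
qed

lemma ptl_X_iter:
  assumes "valid w"
  shows "ptl (w (x+k,y,z+k*y)) = (fst (ptl (w (x,y,z))), snd (ptl (w (x,y,z))) + of_int k * fst (ptl (w (x,y,z))))"
proof (induction k rule: int_induct[where k=0])
  case base
  then show ?case by simp
next
  case (step1 i)
  then show ?case using valid_X(1)[OF assms, of "x+i" y "z+i*y"]
    by (simp add: algebra_simps sh_def)
next
  case (step2 i)
  then show ?case using valid_X(1)[OF assms, of "x+(i-1)" y "z+(i-1)*y"]
    by (auto simp: algebra_simps prod_eq_iff)
qed

section \<open>Rigidity of the point labels\<close>

text \<open>A blank line has \<open>pen\<close> equal to 0. Leaving it, \<open>pen\<close> becomes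
  \<open>(1,0)\<close> and then grows by 0 or 1 per step, so it can return to 0 only after a full
  period of the characteristic.\<close>

lemma lnl_zero_spacing:
  fixes w :: "heis \<Rightarrow> ('a::field, 'b::field) tile"
  assumes "valid w" "lnl (w (x,y,z)) = 0" "lnl (w (x+int k,y,z+int k*y)) = 0" "k < CHAR('b)"
  shows "k = 0"
proof (rule ccontr)
  assume "k \<noteq> 0"
  have LD: "st (w g) = LineDeep" if "lnl (w g) = 0" for g
    by (rule status_cases[of "w g"]) (use that tile_Same[OF assms(1), of g] tile_PointDeep[OF assms(1), of g] in auto)
  have "\<exists>i. 0 < i \<and> i \<le> Suc j \<and> pen (w (x+int (Suc j),y,z+int (Suc j)*y)) = (of_nat i, 0)" for j
  proof (induction j)
    case 0
    show ?case
      using valid_X(2)[OF assms(1), of x y z] LD[OF assms(2)] tile_LineDeep(1)[OF assms(1) LD[OF assms(2)]]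
      by (intro exI[of _ 1]) (auto simp: prod_eq_iff)
  next
    case (Suc j)
    then obtain i where i: "0 < i" "i \<le> Suc j" "pen (w (x+int (Suc j),y,z+int (Suc j)*y)) = (of_nat i, 0)" by auto
    have eq: "(x + int (Suc (Suc j)), y, z + int (Suc (Suc j)) * y) = (x+int (Suc j)+1,y,z+int (Suc j)*y+y)"
      by (simp add: algebra_simps)
    show ?case
      unfolding eq valid_X(2)[OF assms(1)] i(3) using i
      by (cases "st (w (x+int (Suc j),y,z+int (Suc j)*y)) = PointDeep")
         (auto simp: inc_def intro: exI[of _ i] exI[of _ "Suc i"])
  qed
  from this[of "k-1"] \<open>k \<noteq> 0\<close> obtain i where "0 < i" "i \<le> k" "pen (w (x+int k,y,z+int k*y)) = (of_nat i, 0)" by auto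
  moreover have "pen (w (x+int k,y,z+int k*y)) = 0"
    using tile_LineDeep(1)[OF assms(1) LD[OF assms(3)]] .
  ultimately have "(of_nat i :: 'b) = 0" by (simp add: prod_eq_iff)
  then have "CHAR('b) dvd i" by (simp add: of_nat_eq_0_iff_char_dvd)
  then show False using \<open>0 < i\<close> \<open>i \<le> k\<close> assms(4) by (auto dest: dvd_imp_le)
qed

lemma lnl_zero_spacing_int:
  fixes w :: "heis \<Rightarrow> ('a::field, 'b::field) tile"
  assumes "valid w" "lnl (w (x,y,v+x*y)) = 0" "lnl (w (x',y,v+x'*y)) = 0" "\<bar>x - x'\<bar> < int CHAR('b)"
  shows "x = x'"
proof (cases "x \<le> x'")
  case True
  then show ?thesis
    using lnl_zero_spacing[of w x y "v+x*y" "nat (x'-x)"] assms by (auto simp: algebra_simps nat_less_iff)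
next
  case False
  then show ?thesis
    using lnl_zero_spacing[of w x' y "v+x'*y" "nat (x-x')"] assms by (auto simp: algebra_simps nat_less_iff)
qed

text \<open>If both statuses are \<open>Same\<close>, the two labels are successive values of
  \<open>row\<close>. On a line that is not blank, \<open>LineDeep\<close> makes the second
  coordinate vanish at once, and \<open>PointDeep\<close> sets \<open>row\<close> to 0, which makes
  it vanish at a neighbour of status \<open>Same\<close>.\<close>

lemma row_adjacent:
  assumes "valid w" "lnl (w (x,y,z)) \<noteq> 0"
  shows "snd (ptl (w (x,y,z))) = 0 \<or> snd (ptl (w (x,y+1,z))) = 0 \<or> ptl (w (x,y+1,z)) = inc (ptl (w (x,y,z)))"
proof -
  have l: "lnl (w (x,y+1,z)) \<noteq> 0" using valid_Y(1)[OF assms(1), of x y z] assms(2) by simp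
  show ?thesis
    using valid_Y(2)[OF assms(1), of x y z] l assms(2)
      tile_Same[OF assms(1), of "(x,y,z)"] tile_Same[OF assms(1), of "(x,y+1,z)"]
      tile_PointDeep(1)[OF assms(1), of "(x,y,z)"] tile_PointDeep(1)[OF assms(1), of "(x,y+1,z)"]
      tile_LineDeep(4)[OF assms(1), of "(x,y,z)"] tile_LineDeep(4)[OF assms(1), of "(x,y+1,z)"]
    by (cases rule: status_cases[of "w (x,y,z)"]; cases rule: status_cases[of "w (x,y+1,z)"])
       (auto simp: prod_eq_iff)
qed

lemma ptl_zero_right:
  assumes "valid w" "ptl (w (x,y,z)) = 0"
  shows "ptl (w (x,y+1,z)) \<noteq> 0" "snd (ptl (w (x,y+1,z))) = 0"
proof -
  have s: "st (w (x,y,z)) = PointDeep"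
    by (rule status_cases[of "w (x,y,z)"])
       (use assms(2) tile_Same[OF assms(1), of "(x,y,z)"] tile_LineDeep[OF assms(1), of "(x,y,z)"] in auto)
  have l: "lnl (w (x,y+1,z)) \<noteq> 0"
    using valid_Y(1)[OF assms(1), of x y z] tile_PointDeep(2)[OF assms(1) s] by simp
  have r: "row (w (x,y+1,z)) = (1,0)"
    using valid_Y(2)[OF assms(1), of x y z] tile_PointDeep(1)[OF assms(1) s] s by (simp add: prod_eq_iff)
  show "ptl (w (x,y+1,z)) \<noteq> 0" "snd (ptl (w (x,y+1,z))) = 0"
    using r l tile_Same[OF assms(1), of "(x,y+1,z)"] tile_PointDeep(1)[OF assms(1), of "(x,y+1,z)"]
      tile_LineDeep[OF assms(1), of "(x,y+1,z)"]
    by (cases rule: status_cases[of "w (x,y+1,z)"]; auto simp: prod_eq_iff)+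
qed

lemma ptl_zero_left:
  assumes "valid w" "ptl (w (x,y+1,z)) = 0"
  shows "ptl (w (x,y,z)) \<noteq> 0" "snd (ptl (w (x,y,z))) = 0"
proof -
  have s: "st (w (x,y+1,z)) = PointDeep"
    by (rule status_cases[of "w (x,y+1,z)"])
       (use assms(2) tile_Same[OF assms(1), of "(x,y+1,z)"] tile_LineDeep[OF assms(1), of "(x,y+1,z)"] in auto)
  have l: "lnl (w (x,y,z)) \<noteq> 0"
    using valid_Y(1)[OF assms(1), of x y z] tile_PointDeep(2)[OF assms(1) s] by simp
  have r: "row (w (x,y+1,z)) = 0"
    using tile_PointDeep(1)[OF assms(1) s] .
  show "ptl (w (x,y,z)) \<noteq> 0" "snd (ptl (w (x,y,z))) = 0"
    using r l tile_Same[OF assms(1), of "(x,y,z)"] tile_PointDeep(1)[OF assms(1), of "(x,y,z)"]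
      tile_LineDeep[OF assms(1), of "(x,y,z)"] valid_Y(2)[OF assms(1), of x y z]
    by (cases rule: status_cases[of "w (x,y,z)"]; auto simp: prod_eq_iff)+
qed


text \<open>Along the pencil of a point its label is only sheared, so the value on the line of slope
  0 represents the point \<open>(y, v)\<close> itself.\<close>

definition pt :: "(heis \<Rightarrow> ('a, 'b) tile) \<Rightarrow> int \<Rightarrow> int \<Rightarrow> 'a \<times> 'a" where
  "pt w y v = ptl (w (0, y, v))"

lemma ptl_conv_pt:
  assumes "valid w"
  shows "ptl (w (x,y,z)) = (fst (pt w y (z-x*y)), snd (pt w y (z-x*y)) + of_int x * fst (pt w y (z-x*y)))"
  using ptl_X_iter[OF assms, of 0 x y "z-x*y"] by (simp add: pt_def)

text \<open>The line \<open>(x, z)\<close> through \<open>(y, v)\<close> and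
  \<open>(y+1, v')\<close> satisfies \<open>v = z - x*y\<close> and \<open>v' = z - x*(y+1)\<close>;
  thus \<open>x = v - v'\<close>.\<close>

definition blank_join :: "(heis \<Rightarrow> ('a::field, 'b::field) tile) \<Rightarrow> int \<Rightarrow> int \<Rightarrow> int \<Rightarrow> bool" where
  "blank_join w y v v' \<longleftrightarrow> lnl (w (v-v', y, v+(v-v')*y)) = 0"

lemma blank_join_unique:
  fixes w :: "heis \<Rightarrow> ('a::field, 'b::field) tile"
  assumes "valid w" "blank_join w y v v1" "blank_join w y v v2" "\<bar>v1 - v2\<bar> < int CHAR('b)"
  shows "v1 = v2"
  using lnl_zero_spacing_int[OF assms(1), of "v-v1" y v "v-v2"] assms by (auto simp: blank_join_def)

lemma pt_adjacent:
  assumes "valid w" "\<not> blank_join w y v v'"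
  defines "e \<equiv> of_int v - of_int v'"
  shows "snd (pt w y v) + e * fst (pt w y v) = 0 \<or> snd (pt w (y+1) v') + e * fst (pt w (y+1) v') = 0
    \<or> pt w (y+1) v' = (fst (pt w y v) + 1, snd (pt w y v) - e)"
proof -
  have [simp]: "of_int (v - v') = e" by (simp add: e_def)
  have "v + (v-v')*y - (v-v')*y = v" "v + (v-v')*y - (v-v')*(y+1) = v'"
    by (simp_all add: algebra_simps)
  then have 1: "ptl (w (v-v',y,v+(v-v')*y)) = (fst (pt w y v), snd (pt w y v) + e * fst (pt w y v))"
    and 2: "ptl (w (v-v',y+1,v+(v-v')*y)) = (fst (pt w (y+1) v'), snd (pt w (y+1) v') + e * fst (pt w (y+1) v'))"
    by (simp_all add: ptl_conv_pt[OF assms(1)] del: of_int_diff)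
  show ?thesis
    using row_adjacent[OF assms(1), of "v-v'" y "v+(v-v')*y"] assms(2)
    unfolding 1 2 blank_join_def by (auto simp: prod_eq_iff algebra_simps)
qed

lemma pt_zero_right:
  assumes "valid w" "pt w y v = 0"
  shows "pt w (y+1) v' \<noteq> 0"
    and "snd (pt w (y+1) v') + (of_int v - of_int v') * fst (pt w (y+1) v') = 0"
proof -
  have "v + (v-v')*y - (v-v')*y = v" "v + (v-v')*y - (v-v')*(y+1) = v'"
    by (simp_all add: algebra_simps)
  then have 1: "ptl (w (v-v',y,v+(v-v')*y)) = 0"
    and 2: "ptl (w (v-v',y+1,v+(v-v')*y)) = (fst (pt w (y+1) v'), snd (pt w (y+1) v') + (of_int v - of_int v') * fst (pt w (y+1) v'))"
    using assms(2) by (simp_all add: ptl_conv_pt[OF assms(1)] prod_eq_iff)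
  show "pt w (y+1) v' \<noteq> 0"
    and "snd (pt w (y+1) v') + (of_int v - of_int v') * fst (pt w (y+1) v') = 0"
    using ptl_zero_right[OF assms(1) 1] unfolding 2 by (auto simp: prod_eq_iff)
qed

lemma pt_zero_left:
  assumes "valid w" "pt w (y+1) v' = 0"
  shows "pt w y v \<noteq> 0"
    and "snd (pt w y v) + (of_int v - of_int v') * fst (pt w y v) = 0"
proof -
  have "v + (v-v')*y - (v-v')*y = v" "v + (v-v')*y - (v-v')*(y+1) = v'"
    by (simp_all add: algebra_simps)
  then have 1: "ptl (w (v-v',y+1,v+(v-v')*y)) = 0"
    and 2: "ptl (w (v-v',y,v+(v-v')*y)) = (fst (pt w y v), snd (pt w y v) + (of_int v - of_int v') * fst (pt w y v))"
    using assms(2) by (simp_all add: ptl_conv_pt[OF assms(1)] prod_eq_iff)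
  show "pt w y v \<noteq> 0"
    and "snd (pt w y v) + (of_int v - of_int v') * fst (pt w y v) = 0"
    using ptl_zero_left[OF assms(1) 1] unfolding 2 by (auto simp: prod_eq_iff)
qed

lemma affine_root_unique:
  fixes a :: "'a::field"
  assumes "a \<noteq> 0" "b + x * a = 0" "b + y * a = 0"
  shows "x = y"
  using assms by (metis add_left_imp_eq mult_right_cancel)

text \<open>A blank point forces the label of every point in the preceding column to have second
  coordinate 0 on the joining line. For one fixed point this is a nonconstant affine equation in the
  height of the blank point.\<close>

lemma pt_zero_unique:
  fixes w :: "heis \<Rightarrow> ('a::field, 'b::field) tile"
  assumes "valid w" "pt w y v1 = 0" "pt w y v2 = 0"
  shows "(of_int v1 :: 'a) = of_int v2"
proof -
  let ?a = "pt w (y-1) 0"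
  have a: "?a \<noteq> 0" "snd ?a + (0 - of_int v1) * fst ?a = 0" "snd ?a + (0 - of_int v2) * fst ?a = 0"
    using pt_zero_left[OF assms(1), of "y-1" v1 0] pt_zero_left[OF assms(1), of "y-1" v2 0] assms(2,3) by auto
  then have "fst ?a \<noteq> 0" by (auto simp: prod_eq_iff)
  from affine_root_unique[OF this a(2,3)] show ?thesis by simp
qed

lemma window_unique:
  assumes "x \<in> {0..<8}" "y \<in> {0..<8::int}" "(of_int x :: 'a::large_prime_field) = of_int y"
  shows "x = y"
  using assms CHAR_large[where ?'a='a] by (intro of_int_inj_on_window[where ?'a='a]) auto

text \<open>
  Any two points of adjacent columns are joined by exactly one line. If the conclusion failed, each of
  seven conditions would exclude at most one point in a window of eight points of the next column,
  and the remaining point would contradict the adjacency rule.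
\<close>

lemma pt_column_pair:
  fixes w :: "heis \<Rightarrow> ('a::large_prime_field, 'b::large_prime_field) tile"
  assumes w: "valid w" and ne: "(of_int v1 :: 'a) \<noteq> of_int v2"
    and nz: "pt w y v1 \<noteq> 0" "pt w y v2 \<noteq> 0"
  shows "(fst (pt w y v1) = fst (pt w y v2) \<and> of_int v1 - snd (pt w y v1) = of_int v2 - snd (pt w y v2))
    \<or> (fst (pt w y v1) = 0 \<and> of_int v1 - snd (pt w y v1) = of_int v2)
    \<or> (fst (pt w y v2) = 0 \<and> of_int v2 - snd (pt w y v2) = of_int v1)"
proof (rule ccontr)
  assume H: "\<not> ?thesis"
  define a where "a = pt w y v1"
  define a' where "a' = pt w y v2"
  define b where "b = (\<lambda>v'. pt w (y+1) v')"
  define e where "e = (\<lambda>v' :: int. (of_int v1 - of_int v' :: 'a))"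
  define e' where "e' = (\<lambda>v' :: int. (of_int v2 - of_int v' :: 'a))"
  have H1: "\<not> (fst a = fst a' \<and> of_int v1 - snd a = of_int v2 - snd a')"
    and H2: "fst a \<noteq> 0 \<or> of_int v1 - snd a \<noteq> of_int v2"
    and H3: "fst a' \<noteq> 0 \<or> of_int v2 - snd a' \<noteq> of_int v1"
    using H unfolding a_def a'_def by blast+
  \<comment> \<open>The last two conditions say that the label predicted at \<open>v'\<close> by one
    point has second coordinate 0 on the join with the other point. They are affine in
    \<open>v'\<close> with slope \<open>- fst a\<close> or \<open>- fst a'\<close>, and become
    identities exactly in the exceptional cases excluded by \<open>H2\<close> and
    \<open>H3\<close>.\<close>
  let ?Ps = "[blank_join w y v1, blank_join w y v2,
     \<lambda>v'. snd a + e v' * fst a = 0, \<lambda>v'. snd a' + e' v' * fst a' = 0, \<lambda>v'. b v' = 0,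
     \<lambda>v'. (snd a - e v') + e' v' * (fst a + 1) = 0, \<lambda>v'. (snd a' - e' v') + e v' * (fst a' + 1) = 0]"
  have CH: "11 \<le> CHAR('b)" by (rule CHAR_large)
  have "\<exists>v'\<in>{0..<8}. \<forall>P\<in>set ?Ps. \<not> P v'"
  proof (rule ex_int_avoiding_all)
    fix P and s t :: int
    assume P: "P \<in> set ?Ps" and st: "s \<in> {0..<8}" "t \<in> {0..<8}" "P s" "P t"
    have inj: "s = t" if "(of_int s :: 'a) = of_int t" using window_unique[OF st(1,2) that] .
    consider "P = blank_join w y v1" | "P = blank_join w y v2"
      | "P = (\<lambda>v'. snd a + e v' * fst a = 0)" | "P = (\<lambda>v'. snd a' + e' v' * fst a' = 0)"
      | "P = (\<lambda>v'. b v' = 0)"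
      | "P = (\<lambda>v'. (snd a - e v') + e' v' * (fst a + 1) = 0)"
      | "P = (\<lambda>v'. (snd a' - e' v') + e v' * (fst a' + 1) = 0)"
      using P by auto
    then show "s = t"
    proof cases
      case 1
      then show ?thesis using blank_join_unique[OF w, of y v1 s t] st CH by auto
    next
      case 2
      then show ?thesis using blank_join_unique[OF w, of y v2 s t] st CH by auto
    next
      case 3
      then have "fst a \<noteq> 0" using nz st(3) by (auto simp: a_def prod_eq_iff)
      then show ?thesis using affine_root_unique[of "fst a" "snd a" "e s" "e t"] 3 st inj by (auto simp: e_def)
    next
      case 4
      then have "fst a' \<noteq> 0" using nz st(3) by (auto simp: a'_def prod_eq_iff)
      then show ?thesis using affine_root_unique[of "fst a'" "snd a'" "e' s" "e' t"] 4 st inj by (auto simp: e'_def)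
    next
      case 5
      then show ?thesis using pt_zero_unique[OF w, of "y+1" s t] st inj by (auto simp: b_def)
    next
      case 6
      have *: "(snd a - of_int v1 + of_int v2 * (fst a + 1)) + of_int k * (- fst a) = (snd a - e k) + e' k * (fst a + 1)" for k
        by (simp add: e_def e'_def algebra_simps)
      have "fst a \<noteq> 0" using H2 6 st(3) by (auto simp: e_def e'_def algebra_simps)
      then show ?thesis
        using affine_root_unique[of "- fst a" "snd a - of_int v1 + of_int v2 * (fst a + 1)" "of_int s" "of_int t"]
          6 st inj unfolding * by auto
    next
      case 7
      have *: "(snd a' - of_int v2 + of_int v1 * (fst a' + 1)) + of_int k * (- fst a') = (snd a' - e' k) + e k * (fst a' + 1)" for k
        by (simp add: e_def e'_def algebra_simps)
      have "fst a' \<noteq> 0" using H3 7 st(3) by (auto simp: e_def e'_def algebra_simps)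
      then show ?thesis
        using affine_root_unique[of "- fst a'" "snd a' - of_int v2 + of_int v1 * (fst a' + 1)" "of_int s" "of_int t"]
          7 st inj unfolding * by auto
    qed
  qed simp
  then obtain v' where nb: "\<not> blank_join w y v1 v'" "\<not> blank_join w y v2 v'"
    and npa: "snd a + e v' * fst a \<noteq> 0" "snd a' + e' v' * fst a' \<noteq> 0" and bz: "b v' \<noteq> 0"
    and n6: "(snd a - e v') + e' v' * (fst a + 1) \<noteq> 0" and n7: "(snd a' - e' v') + e v' * (fst a' + 1) \<noteq> 0"
    by auto
  have A: "snd (b v') + e v' * fst (b v') = 0 \<or> b v' = (fst a + 1, snd a - e v')"
    using pt_adjacent[OF w nb(1)] npa(1) by (auto simp: a_def b_def e_def)
  have A': "snd (b v') + e' v' * fst (b v') = 0 \<or> b v' = (fst a' + 1, snd a' - e' v')"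
    using pt_adjacent[OF w nb(2)] npa(2) by (auto simp: a'_def b_def e'_def)
  show False
  proof (cases "b v' = (fst a + 1, snd a - e v')")
    case True
    then have "b v' = (fst a' + 1, snd a' - e' v')" using A' n6 by auto
    then have "fst a = fst a'" "snd a - e v' = snd a' - e' v'" using True by auto
    then show False using H1 by (auto simp: e_def e'_def algebra_simps)
  next
    case F: False
    then have p: "snd (b v') + e v' * fst (b v') = 0" using A by auto
    then have p': "snd (b v') + e' v' * fst (b v') = 0" using A' n7 by auto
    have "fst (b v') \<noteq> 0" using p bz by (auto simp: prod_eq_iff)
    from affine_root_unique[OF this p p'] show False using ne by (auto simp: e_def e'_def)
  qed
qed

text \<open>\<open>d v\<close> is the centre to which the label of \<open>v\<close> points. Two
  points agree on it unless one of them takes the other as its centre. If some \<open>v2\<close>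
  takes \<open>v1\<close> as centre while \<open>v1\<close> disagrees, the remaining points side
  with \<open>v2\<close>; otherwise they side with \<open>v1\<close>.\<close>

lemma pt_column:
  fixes w :: "heis \<Rightarrow> ('a::large_prime_field, 'b::large_prime_field) tile"
  assumes w: "valid w"
  obtains u k where "\<And>v. pt w y v \<noteq> 0 \<Longrightarrow> (u, of_int v - k) \<noteq> 0 \<Longrightarrow> pt w y v = (u, of_int v - k)"
proof -
  define d where "d v = (fst (pt w y v), of_int v - snd (pt w y v))" for v
  have dD: "pt w y v = (u, of_int v - k)" if "d v = (u,k)" for v u k
    using that by (auto simp: d_def prod_eq_iff)
  have P: "d v1 = d v2 \<or> d v1 = (0, of_int v2) \<or> d v2 = (0, of_int v1)"
    if "(of_int v1 :: 'a) \<noteq> of_int v2" "pt w y v1 \<noteq> 0" "pt w y v2 \<noteq> 0" for v1 v2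
    using pt_column_pair[OF w that] by (simp add: d_def)
  have ex: "\<exists>v. pt w y v \<noteq> 0 \<and> (\<forall>c\<in>set cs. of_int v \<noteq> c)" if "length cs < 7" for cs :: "'a list"
  proof -
    have "\<exists>v\<in>{0..<8::int}. \<forall>P\<in>set ((\<lambda>v. pt w y v = 0) # map (\<lambda>c v. of_int v = c) cs). \<not> P v"
    proof (rule ex_int_avoiding_all)
      fix Q and s t :: int
      assume *: "Q \<in> set ((\<lambda>v. pt w y v = 0) # map (\<lambda>c v. of_int v = c) cs)"
        "s \<in> {0..<8}" "t \<in> {0..<8}" "Q s" "Q t"
      then have "(of_int s :: 'a) = of_int t" using pt_zero_unique[OF w, of y s t] by auto
      then show "s = t" using window_unique[OF *(2,3)] by blast
    qed (use that in simp)
    then show ?thesis by auto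
  qed
  obtain v1 where v1: "pt w y v1 \<noteq> 0" using ex[of "[]"] by auto
  show ?thesis
  proof (cases "\<exists>v2. pt w y v2 \<noteq> 0 \<and> (of_int v2 :: 'a) \<noteq> of_int v1 \<and> d v1 \<noteq> (0, of_int v2) \<and> d v2 \<noteq> d v1")
    case True
    then obtain v2 where v2: "pt w y v2 \<noteq> 0" "(of_int v2 :: 'a) \<noteq> of_int v1" "d v1 \<noteq> (0, of_int v2)" "d v2 \<noteq> d v1"
      by auto
    have d2: "d v2 = (0, of_int v1)" using P[of v1 v2] v1 v2 by auto
    have gen: "d v3 = (0, of_int v1)" if "pt w y v3 \<noteq> 0" "(of_int v3 :: 'a) \<noteq> of_int v1"
      "(of_int v3 :: 'a) \<noteq> of_int v2" "of_int v3 \<noteq> snd (d v1)" for v3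
      using P[of v1 v3] P[of v2 v3] v1 v2 d2 that by auto
    show ?thesis
    proof (rule that[of 0 "of_int v1"])
      fix v assume v: "pt w y v \<noteq> 0" "(0::'a, of_int v - of_int v1 :: 'a) \<noteq> 0"
      then have vn: "(of_int v :: 'a) \<noteq> of_int v1" by (auto simp: prod_eq_iff)
      \<comment> \<open>Two auxiliary points are used because \<open>v\<close> might take one of
        them as its centre, but it cannot take both.\<close>
      obtain v3 where v3: "pt w y v3 \<noteq> 0" "of_int v3 \<noteq> (of_int v1 :: 'a)" "of_int v3 \<noteq> (of_int v2 :: 'a)"
         "of_int v3 \<noteq> snd (d v1)" "of_int v3 \<noteq> (of_int v :: 'a)"
        using ex[of "[of_int v1, of_int v2, snd (d v1), of_int v]"] by auto
      obtain v4 where v4: "pt w y v4 \<noteq> 0" "of_int v4 \<noteq> (of_int v1 :: 'a)" "of_int v4 \<noteq> (of_int v2 :: 'a)"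
         "of_int v4 \<noteq> snd (d v1)" "of_int v4 \<noteq> (of_int v :: 'a)" "of_int v4 \<noteq> (of_int v3 :: 'a)"
        using ex[of "[of_int v1, of_int v2, snd (d v1), of_int v, of_int v3]"] by auto
      have "d v = (0, of_int v1)"
        using gen[of v3] gen[of v4] P[of v3 v] P[of v4 v] v3 v4 v vn by auto
      then show "pt w y v = (0, of_int v - of_int v1)" by (rule dD)
    qed
  next
    case False
    then have all: "d v2 = d v1" if "pt w y v2 \<noteq> 0" "(of_int v2 :: 'a) \<noteq> of_int v1" "d v1 \<noteq> (0, of_int v2)" for v2
      using that by blast
    show ?thesis
    proof (rule that[of "fst (d v1)" "snd (d v1)"])
      fix v assume v: "pt w y v \<noteq> 0" "(fst (d v1), of_int v - snd (d v1)) \<noteq> 0"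
      then have vn: "d v1 \<noteq> (0, of_int v)" by (auto simp: prod_eq_iff)
      have "d v = d v1"
      proof (cases "(of_int v :: 'a) = of_int v1")
        case True
        obtain v3 where v3: "pt w y v3 \<noteq> 0" "of_int v3 \<noteq> (of_int v1 :: 'a)" "of_int v3 \<noteq> snd (d v1)"
          using ex[of "[of_int v1, snd (d v1)]"] by auto
        obtain v4 where v4: "pt w y v4 \<noteq> 0" "of_int v4 \<noteq> (of_int v1 :: 'a)" "of_int v4 \<noteq> snd (d v1)" "of_int v4 \<noteq> (of_int v3 :: 'a)"
          using ex[of "[of_int v1, snd (d v1), of_int v3]"] by auto
        have "d v3 = d v1" "d v4 = d v1" using all v3 v4 by (metis snd_conv)+
        then show ?thesis using P[of v3 v] P[of v4 v] v3 v4 v vn True by auto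
      qed (use all v vn in auto)
      then show "pt w y v = (fst (d v1), of_int v - snd (d v1))" by (intro dD) simp
    qed
  qed
qed

text \<open>For a generic pair of points in the two columns only the third alternative of
  \<open>pt_adjacent\<close> survives, and it compares the two centres.\<close>

lemma pt_column_step:
  fixes w :: "heis \<Rightarrow> ('a::large_prime_field, 'b::large_prime_field) tile"
  assumes w: "valid w"
    and c: "\<And>v. pt w y v \<noteq> 0 \<Longrightarrow> (u, of_int v - k) \<noteq> 0 \<Longrightarrow> pt w y v = (u, of_int v - k)"
    and c': "\<And>v. pt w (y+1) v \<noteq> 0 \<Longrightarrow> (u', of_int v - k') \<noteq> 0 \<Longrightarrow> pt w (y+1) v = (u', of_int v - k')"
  shows "u' = u + 1" "k' = k"
proof -
  have "\<exists>v\<in>{0..<8::int}. \<forall>P\<in>set [\<lambda>v. pt w y v = 0, \<lambda>v. of_int v = k, \<lambda>v. of_int v = k']. \<not> P v"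
  proof (rule ex_int_avoiding_all)
    fix Q and s t :: int
    assume *: "Q \<in> set [\<lambda>v. pt w y v = 0, \<lambda>v. of_int v = k, \<lambda>v. of_int v = k']"
      "s \<in> {0..<8}" "t \<in> {0..<8}" "Q s" "Q t"
    then have "(of_int s :: 'a) = of_int t" using pt_zero_unique[OF w, of y s t] by auto
    then show "s = t" using window_unique[OF *(2,3)] by blast
  qed simp
  then obtain v where v: "pt w y v \<noteq> 0" "of_int v \<noteq> k" "of_int v \<noteq> k'" by auto
  then have a: "pt w y v = (u, of_int v - k)" using c[of v] by (auto simp: prod_eq_iff)
  let ?Ps = "[blank_join w y v, \<lambda>t. of_int v - k + (of_int v - of_int t) * u = 0, \<lambda>t. pt w (y+1) t = 0,
    \<lambda>t. of_int t = k', \<lambda>t. of_int t - k' + (of_int v - of_int t) * u' = 0]"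
  have "\<exists>t\<in>{0..<8::int}. \<forall>P\<in>set ?Ps. \<not> P t"
  proof (rule ex_int_avoiding_all)
    fix P and s t :: int
    assume P: "P \<in> set ?Ps" and st: "s \<in> {0..<8}" "t \<in> {0..<8}" "P s" "P t"
    have inj: "s = t" if "(of_int s :: 'a) = of_int t" using window_unique[OF st(1,2) that] .
    consider "P = blank_join w y v" | "P = (\<lambda>t. of_int v - k + (of_int v - of_int t) * u = 0)"
      | "P = (\<lambda>t. pt w (y+1) t = 0)" | "P = (\<lambda>t. of_int t = k')"
      | "P = (\<lambda>t. of_int t - k' + (of_int v - of_int t) * u' = 0)"
      using P by auto
    then show "s = t"
    proof cases
      case 1
      then show ?thesis using blank_join_unique[OF w, of y v s t] st CHAR_large[where ?'a='b] by auto
    next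
      case 2
      then have "u \<noteq> 0" using v st by auto
      then show ?thesis
        using affine_root_unique[of u "of_int v - k" "of_int v - of_int s" "of_int v - of_int t"] 2 st inj by auto
    next
      case 3
      then show ?thesis using pt_zero_unique[OF w, of "y+1" s t] st inj by auto
    next
      case 4
      then show ?thesis using st inj by auto
    next
      case 5
      have *: "(of_int v * u' - k') + of_int t * (1 - u') = of_int t - k' + (of_int v - of_int t) * u'" for t
        by (simp add: algebra_simps)
      have "1 - u' \<noteq> 0" using v(3) 5 st(3) by (auto simp: algebra_simps)
      then show ?thesis
        using affine_root_unique[of "1-u'" "of_int v * u' - k'" "of_int s" "of_int t"] 5 st inj unfolding * by auto
    qed
  qed simp
  then obtain t where nb: "\<not> blank_join w y v t" and t: "of_int v - k + (of_int v - of_int t) * u \<noteq> 0"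
    "pt w (y+1) t \<noteq> 0" "of_int t \<noteq> k'" "of_int t - k' + (of_int v - of_int t) * u' \<noteq> 0" by auto
  have b: "pt w (y+1) t = (u', of_int t - k')" using c'[of t] t by (auto simp: prod_eq_iff)
  have "u' = u + 1 \<and> of_int t - k' = of_int v - k - (of_int v - of_int t)"
    using pt_adjacent[OF w nb] t unfolding a b by auto
  then show "u' = u + 1" "k' = k" by (auto simp: algebra_simps)
qed

lemma pt_rigid:
  fixes w :: "heis \<Rightarrow> ('a::large_prime_field, 'b::large_prime_field) tile"
  assumes w: "valid w"
  obtains \<alpha> \<beta> :: int where "\<And>y v. (of_int (y-\<alpha>), of_int (v-\<beta>)) \<noteq> (0 :: 'a \<times> 'a)
      \<Longrightarrow> pt w y v = (of_int (y-\<alpha>), of_int (v-\<beta>))"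
proof -
  have "\<exists>u k. \<forall>v. pt w y v \<noteq> 0 \<longrightarrow> (u, of_int v - k) \<noteq> 0 \<longrightarrow> pt w y v = (u, of_int v - k)" for y
    using pt_column[OF w, of y] by metis
  then obtain u k where c: "\<And>y v. pt w y v \<noteq> 0 \<Longrightarrow> (u y, of_int v - k y) \<noteq> 0 \<Longrightarrow> pt w y v = (u y, of_int v - k y)"
    by metis
  have step: "u (y+1) = u y + 1" "k (y+1) = k y" for y
    using pt_column_step[OF w c c] by auto
  have u: "u y = u 0 + of_int y" for y
  proof (induction y rule: int_induct[where k=0])
    case (step2 i)
    then show ?case using step(1)[of "i-1"] by (simp add: algebra_simps)
  qed (simp_all add: step(1) algebra_simps)
  have k: "k y = k 0" for y
  proof (induction y rule: int_induct[where k=0])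
    case (step2 i)
    then show ?case using step(2)[of "i-1"] by simp
  qed (simp_all add: step(2))
  obtain \<alpha> \<beta> where ab: "- u 0 = of_int \<alpha>" "k 0 = of_int \<beta>" using ex_of_int by metis
  have uk: "u y = of_int (y - \<alpha>)" "of_int v - k y = of_int (v - \<beta>)" for y v
    using u[of y] k[of y] ab by (simp_all add: minus_equation_iff[of "u 0"])
  have nz: "pt w y v \<noteq> 0" if "(of_int (y-\<alpha>), of_int (v-\<beta>)) \<noteq> (0 :: 'a \<times> 'a)" for y v
  proof
    assume z: "pt w y v = 0"
    have *: "of_int t - k y + (of_int v - of_int t) * (u y + 1) = 0" if "of_int t \<noteq> k y" for t
    proof -
      have "pt w (y+1) t = (u (y+1), of_int t - k (y+1))"
        by (rule c) (use pt_zero_right(1)[OF w z, of t] that step(2) in \<open>auto simp: prod_eq_iff\<close>)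
      then show ?thesis using pt_zero_right(2)[OF w z, of t] step by simp
    qed
    \<comment> \<open>A blank point at height \<open>v\<close> imposes the equation * at all heights
      except \<open>k y\<close>. The two heights next to it already leave only the centre itself, as
      2 is invertible.\<close>
    obtain s where s: "of_int s = k y + 1" using ex_of_int by metis
    obtain t where t: "of_int t = k y - 1" using ex_of_int by metis
    have E1: "1 + (of_int v - (k y + 1)) * (u y + 1) = 0" using *[of s] by (simp add: s)
    have E2: "-1 + (of_int v - (k y - 1)) * (u y + 1) = 0" using *[of t] by (simp add: t)
    have "2 * u y = 0" using E1 E2 by (simp add: algebra_simps)
    moreover have "(2::'a) \<noteq> 0"
      using of_int_inj_on_window[of 2 0, where ?'a='a] CHAR_large[where ?'a='a] by auto
    ultimately have "u y = 0" by simp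
    then have "of_int v - k y = 0" using E1 by simp
    then show False using that uk \<open>u y = 0\<close> by (metis zero_prod_def)
  qed
  show ?thesis
    by (rule that[of \<alpha> \<beta>]) (use c nz uk in metis)
qed


section \<open>The first level\<close>

lemma crt_int:
  fixes P Q :: int
  assumes "coprime P Q"
  shows "\<exists>z. P dvd z - a \<and> Q dvd z - b"
proof -
  obtain u v where uv: "u * P + v * Q = 1" using bezout_int[of P Q] assms by auto
  have "a * v * Q + b * u * P - a = P * (b * u - a * u)"
  proof -
    have "v * Q = 1 - u * P" using uv by simp
    then have "a * v * Q = a * (1 - u * P)" by (simp add: mult.assoc)
    then show ?thesis by (simp add: algebra_simps)
  qed
  moreover have "a * v * Q + b * u * P - b = Q * (a * v - b * v)"
  proof -
    have "u * P = 1 - v * Q" using uv by simp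
    then have "b * u * P = b * (1 - v * Q)" by (simp add: mult.assoc)
    then show ?thesis by (simp add: algebra_simps)
  qed
  ultimately show ?thesis by (metis dvd_triv_left)
qed

text \<open>Displacement from a centre at the identity, to first order: the pair
  \<open>(y, z)\<close> is the point \<open>(y, z - x*y)\<close> sheared to the current line. For
  coprime characteristics both phases vanish exactly on the sublattice
  \<open>(q x, p y, p q z)\<close>.\<close>

definition pphase :: "heis \<Rightarrow> 'a::ring_1 \<times> 'a" where
  "pphase g = (case g of (x,y,z) \<Rightarrow> (of_int y, of_int z))"

definition lphase :: "heis \<Rightarrow> 'b::ring_1 \<times> 'b" where
  "lphase g = pphase (dual g)"

lemma pphase_simp[simp]: "pphase (x,y,z) = (of_int y, of_int z)" by (simp add: pphase_def)
lemma lphase_simp[simp]: "lphase (x,y,z) = (of_int x, of_int (x*y-z))" by (simp add: lphase_def)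
lemma pphase_dual[simp]: "pphase (dual g) = lphase g" by (simp add: lphase_def)
lemma lphase_dual[simp]: "lphase (dual g) = pphase g" by (simp add: lphase_def)

text \<open>Where a phase vanishes nothing is demanded: those labels belong to deeper
  levels.\<close>

definition labelled :: "(heis \<Rightarrow> ('a::field, 'b::field) tile) \<Rightarrow> bool" where
  "labelled w \<longleftrightarrow> (\<forall>g. (pphase g \<noteq> (0 :: 'a \<times> 'a) \<longrightarrow> ptl (w g) = pphase g) \<and>
     (lphase g \<noteq> (0 :: 'b \<times> 'b) \<longrightarrow> lnl (w g) = lphase g))"

lemma labelled_ptl:
  fixes w :: "heis \<Rightarrow> ('a::field, 'b::field) tile"
  shows "labelled w \<Longrightarrow> pphase g \<noteq> (0 :: 'a \<times> 'a) \<Longrightarrow> ptl (w g) = pphase g"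
  unfolding labelled_def by blast

lemma labelled_lnl:
  fixes w :: "heis \<Rightarrow> ('a::field, 'b::field) tile"
  shows "labelled w \<Longrightarrow> lphase g \<noteq> (0 :: 'b \<times> 'b) \<Longrightarrow> lnl (w g) = lphase g"
  unfolding labelled_def by blast

lemma labelled_dual: "labelled w \<Longrightarrow> labelled (dual_conf w)"
  unfolding labelled_def dual_conf_def by (metis pphase_dual lphase_dual swap_tile_sel(2,3))

text \<open>Rigidity of \<open>w\<close> and of its dual gives a centre for the points and one for
  the lines. The first two coordinates of the shift are read off; the third must satisfy one
  congruence for the point and one for the line, with coprime moduli.\<close>

lemma ex_labelled_shift:
  fixes w :: "heis \<Rightarrow> ('a::large_prime_field, 'b::large_prime_field) tile"
  assumes w: "valid w" and cop: "coprime CHAR('a) CHAR('b)"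
  shows "\<exists>g. labelled (\<lambda>h. w (hmul h g))"
proof -
  obtain \<alpha> \<beta> where P: "\<And>y v. (of_int (y-\<alpha>), of_int (v-\<beta>)) \<noteq> (0 :: 'a \<times> 'a)
      \<Longrightarrow> pt w y v = (of_int (y-\<alpha>), of_int (v-\<beta>))"
    using pt_rigid[OF w] by metis
  obtain \<alpha>' \<beta>' where L: "\<And>y v. (of_int (y-\<alpha>'), of_int (v-\<beta>')) \<noteq> (0 :: 'b \<times> 'b)
      \<Longrightarrow> pt (dual_conf w) y v = (of_int (y-\<alpha>'), of_int (v-\<beta>'))"
    using pt_rigid[OF valid_dual[OF w]] by metis
  have P': "ptl (w (x,y,z)) = (of_int (y-\<alpha>), of_int (z-\<beta>-x*\<alpha>))"
    if "(of_int (y-\<alpha>), of_int (z-\<beta>-x*\<alpha>)) \<noteq> (0 :: 'a \<times> 'a)" for x y z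
  proof -
    have "(of_int (y-\<alpha>), of_int ((z-x*y)-\<beta>)) \<noteq> (0 :: 'a \<times> 'a)"
    proof
      assume 0: "(of_int (y-\<alpha>), of_int ((z-x*y)-\<beta>)) = (0 :: 'a \<times> 'a)"
      have "(of_int (z-\<beta>-x*\<alpha>) :: 'a) = of_int ((z-x*y)-\<beta>) + of_int x * of_int (y-\<alpha>)"
        by (simp add: algebra_simps)
      then show False using 0 that by (simp add: prod_eq_iff del: of_int_diff of_int_mult)
    qed
    from P[OF this] show ?thesis by (simp add: ptl_conv_pt[OF w] algebra_simps)
  qed
  have L': "lnl (w (x,y,z)) = (of_int (x-\<alpha>'), of_int (x*y-z-\<beta>'-y*\<alpha>'))"
    if "(of_int (x-\<alpha>'), of_int (x*y-z-\<beta>'-y*\<alpha>')) \<noteq> (0 :: 'b \<times> 'b)" for x y z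
  proof -
    have "(of_int (x-\<alpha>'), of_int ((x*y-z-y*x)-\<beta>')) \<noteq> (0 :: 'b \<times> 'b)"
    proof
      assume 0: "(of_int (x-\<alpha>'), of_int ((x*y-z-y*x)-\<beta>')) = (0 :: 'b \<times> 'b)"
      have "(of_int (x*y-z-\<beta>'-y*\<alpha>') :: 'b) = of_int ((x*y-z-y*x)-\<beta>') + of_int y * of_int (x-\<alpha>')"
        by (simp add: algebra_simps)
      then show False using 0 that by (simp add: prod_eq_iff del: of_int_diff of_int_mult)
    qed
    from L[OF this] have "ptl (dual_conf w (y,x,x*y-z)) = (of_int (x-\<alpha>'), of_int (x*y-z-\<beta>'-y*\<alpha>'))"
      by (simp add: ptl_conv_pt[OF valid_dual[OF w]] algebra_simps)
    then show ?thesis by (simp add: dual_conf_def mult.commute)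
  qed
  obtain z where z: "int CHAR('a) dvd z - (\<beta> + \<alpha>' * \<alpha>)" "int CHAR('b) dvd z - (-\<beta>')"
    using crt_int[of "int CHAR('a)" "int CHAR('b)"] cop by (metis coprime_int_iff)
  have za: "(of_int z :: 'a) = of_int \<beta> + of_int \<alpha>' * of_int \<alpha>"
    using z(1) unfolding of_int_eq_iff_CHAR_dvd[symmetric] by simp
  have zb: "(of_int z :: 'b) = - of_int \<beta>'"
    using z(2) unfolding of_int_eq_iff_CHAR_dvd[symmetric] by simp
  show ?thesis
  proof (intro exI[of _ "(\<alpha>',\<alpha>,z)"])
    show "labelled (\<lambda>h. w (hmul h (\<alpha>',\<alpha>,z)))"
      unfolding labelled_def
    proof (intro allI conjI impI)
      fix g :: heis
      obtain a b c where g: "g = (a,b,c)" by (cases g) auto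
      have e1: "(of_int (b+\<alpha>-\<alpha>), of_int (c+z+a*\<alpha>-\<beta>-(a+\<alpha>')*\<alpha>)) = (pphase g :: 'a \<times> 'a)"
        by (simp add: g za algebra_simps)
      have e2: "(of_int (a+\<alpha>'-\<alpha>'), of_int ((a+\<alpha>')*(b+\<alpha>)-(c+z+a*\<alpha>)-\<beta>'-(b+\<alpha>)*\<alpha>')) = (lphase g :: 'b \<times> 'b)"
        by (simp add: g zb algebra_simps)
      show "ptl (w (hmul g (\<alpha>',\<alpha>,z))) = pphase g" if "pphase g \<noteq> (0 :: 'a \<times> 'a)"
        using P'[of "b+\<alpha>" "c+z+a*\<alpha>" "a+\<alpha>'"] that unfolding e1 by (simp add: g)
      show "lnl (w (hmul g (\<alpha>',\<alpha>,z))) = lphase g" if "lphase g \<noteq> (0 :: 'b \<times> 'b)"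
        using L'[of "a+\<alpha>'" "b+\<alpha>" "c+z+a*\<alpha>"] that unfolding e2 by (simp add: g)
    qed
  qed
qed

text \<open>A nonzero second coordinate of the point label excludes \<open>LineDeep\<close>. If the
  second line coordinate vanishes, \<open>PointDeep\<close> is excluded one step along the
  \<open>Y\<close>-line, where that coordinate is \<open>x\<close>: the status there is
  \<open>Same\<close>, and the nonzero second coordinate of its \<open>row\<close> is constant along
  the \<open>Y\<close>-line.\<close>

lemma status_generic:
  fixes w :: "heis \<Rightarrow> ('a::field, 'b::field) tile"
  assumes w: "valid w" and l: "labelled w"
    and U: "snd (pphase g) \<noteq> (0::'a)" and V: "lphase g \<noteq> (0 :: 'b \<times> 'b)"
  shows "st (w g) = Same"
proof -
  have *: "st (w h) \<noteq> LineDeep" if "snd (pphase h) \<noteq> (0::'a)" "lphase h \<noteq> (0 :: 'b \<times> 'b)" for h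
  proof
    assume "st (w h) = LineDeep"
    then have "snd (ptl (w h)) = 0" using tile_LineDeep(4)[OF w, of h] labelled_lnl[OF l, of h] that by auto
    moreover have "ptl (w h) = pphase h" using labelled_ptl[OF l, of h] that by (auto simp: prod_eq_iff)
    ultimately show False using that by simp
  qed
  have **: "st (w h) \<noteq> PointDeep" if "snd (lphase h) \<noteq> (0::'b)" "pphase h \<noteq> (0 :: 'a \<times> 'a)" for h
  proof
    assume "st (w h) = PointDeep"
    then have "snd (lnl (w h)) = 0" using tile_PointDeep(4)[OF w, of h] labelled_ptl[OF l, of h] that by auto
    moreover have "lnl (w h) = lphase h" using labelled_lnl[OF l, of h] that by (auto simp: prod_eq_iff)
    ultimately show False using that by simp
  qed
  obtain x y z where g: "g = (x,y,z)" by (cases g) auto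
  show ?thesis
  proof (cases "snd (lphase g) = (0::'b)")
    case False
    then show ?thesis using *[of g] **[of g] U V by (cases rule: status_cases[of "w g"]) (auto simp: prod_eq_iff)
  next
    case True
    then have x: "(of_int x :: 'b) \<noteq> 0" using V by (auto simp: g prod_eq_iff)
    let ?h = "(x,y+1,z)"
    have s: "snd (lphase ?h) = (of_int x :: 'b)" using True by (simp add: g algebra_simps)
    then have "snd (lphase ?h) \<noteq> (0::'b)" using x by metis
    moreover have "lphase ?h \<noteq> (0 :: 'b \<times> 'b)" "snd (pphase ?h) \<noteq> (0::'a)" "pphase ?h \<noteq> (0 :: 'a \<times> 'a)"
      using x U by (auto simp: g prod_eq_iff)
    ultimately have "st (w ?h) = Same"
      using *[of ?h] **[of ?h] by (cases rule: status_cases[of "w ?h"]) blast+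
    then have "row (w ?h) = pphase ?h"
      using tile_Same(3)[OF w] labelled_ptl[OF l, of ?h] U by (auto simp: g prod_eq_iff)
    then have "snd (row (w g)) \<noteq> 0"
      using valid_Y(2)[OF w, of x y z] U by (auto simp: g inc_def split: if_splits)
    then have "st (w g) \<noteq> PointDeep" using tile_PointDeep(1)[OF w, of g] by auto
    then show ?thesis using *[of g] U V by (cases rule: status_cases[of "w g"]) auto
  qed
qed

lemma status_generic':
  fixes w :: "heis \<Rightarrow> ('a::field, 'b::field) tile"
  assumes w: "valid w" and l: "labelled w"
    and V: "snd (lphase g) \<noteq> (0::'b)" and U: "pphase g \<noteq> (0 :: 'a \<times> 'a)"
  shows "st (w g) = Same"
  using status_generic[OF valid_dual[OF w] labelled_dual[OF l], of "dual g"] assms by (simp add: dual_conf_def)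

lemma row_interpolate:
  fixes w :: "heis \<Rightarrow> ('a::field, 'b::field) tile"
  assumes w: "valid w" and s: "st (w (x,y-1,z)) \<noteq> LineDeep"
    and r: "row (w (x,y-1,z)) = (c-1,0)" "row (w (x,y+1,z)) = (c+1,0)"
  shows "row (w (x,y,z)) = (c,0)" "st (w (x,y,z)) \<noteq> LineDeep"
proof -
  show 1: "row (w (x,y,z)) = (c,0)"
    using valid_Y(2)[OF w, of x "y-1" z] s r(1) by (simp add: prod_eq_iff)
  show "st (w (x,y,z)) \<noteq> LineDeep"
    using valid_Y(2)[OF w, of x y z] 1 r(2) by (auto simp: prod_eq_iff)
qed

text \<open>Between neighbours labelled \<open>(-1,0)\<close> and \<open>(1,0)\<close> the signal
  must be 0, which rules out \<open>Same\<close>. This applies if the second line coordinate is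
  nonzero at both neighbours.\<close>

lemma status_point_deep:
  fixes w :: "heis \<Rightarrow> ('a::field, 'b::field) tile"
  assumes w: "valid w" and l: "labelled w"
    and U: "pphase g = (0 :: 'a \<times> 'a)" and V: "lphase g \<noteq> (0 :: 'b \<times> 'b)"
  shows "st (w g) = PointDeep"
proof -
  have *: "st (w (x,y,z)) = PointDeep"
    if 0: "pphase (x,y,z) = (0 :: 'a \<times> 'a)" and ne: "(of_int (x*y-z) + of_int x :: 'b) \<noteq> 0" "(of_int (x*y-z) - of_int x :: 'b) \<noteq> 0"
    for x y z
  proof -
    have yz: "(of_int y :: 'a) = 0" "(of_int z :: 'a) = 0" using 0 by (auto simp: prod_eq_iff)
    have "st (w (x,y+1,z)) = Same" "st (w (x,y-1,z)) = Same"
      by (rule status_generic'[OF w l]; use ne yz in \<open>simp add: prod_eq_iff algebra_simps\<close>)+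
    moreover have "ptl (w (x,y+1,z)) = (1,0)" "ptl (w (x,y-1,z)) = (-1,0)"
      using labelled_ptl[OF l, of "(x,y+1,z)"] labelled_ptl[OF l, of "(x,y-1,z)"] yz by (auto simp: prod_eq_iff)
    ultimately have "st (w (x,y-1,z)) \<noteq> LineDeep" "row (w (x,y-1,z)) = (0-1,0)" "row (w (x,y+1,z)) = (0+1,0)"
      using tile_Same(3)[OF w] by auto
    from row_interpolate[OF w this] have "row (w (x,y,z)) = (0,0)" "st (w (x,y,z)) \<noteq> LineDeep" .
    then show ?thesis
      using tile_Same(1,3)[OF w, of "(x,y,z)"] by (cases rule: status_cases[of "w (x,y,z)"]) (auto simp: prod_eq_iff)
  qed
  obtain x y z where g: "g = (x,y,z)" by (cases g) auto
  show ?thesis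
  proof (cases "(of_int (x*y-z) :: 'b) = 0")
    case True
    then show ?thesis using *[of x y z] U V by (auto simp: g prod_eq_iff)
  next
    case False
    \<comment> \<open>At slope 0 on the same \<open>X\<close>-line both neighbours have the second
      line coordinate \<open>x*y - z\<close>, which is nonzero here. The point is found blank there,
      and blankness travels back along the pencil.\<close>
    let ?g = "(x+(-x),y,z+(-x)*y)"
    have v: "of_int (0*y - (z+(-x)*y)) = (of_int (x*y-z) :: 'b)" by simp
    have D: "st (w ?g) = PointDeep"
      using *[of 0 y "z+(-x)*y"] U False v by (simp add: g prod_eq_iff)
    have "lnl (w ?g) = lphase ?g" using labelled_lnl[OF l, of ?g] False v by (simp add: prod_eq_iff)
    then have "snd (lnl (w ?g)) \<noteq> 0" using False v by simp
    then have "ptl (w ?g) = 0" using tile_PointDeep(4)[OF w D] by blast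
    then have "ptl (w g) = 0" unfolding ptl_X_iter[OF w] by (auto simp: g prod_eq_iff)
    then show ?thesis
      using tile_Same(1)[OF w, of g] tile_LineDeep(2)[OF w, of g] by (cases rule: status_cases[of "w g"]) auto
  qed
qed

lemma status_same:
  fixes w :: "heis \<Rightarrow> ('a::field, 'b::field) tile"
  assumes w: "valid w" and l: "labelled w"
    and U: "pphase g \<noteq> (0 :: 'a \<times> 'a)" and V: "lphase g \<noteq> (0 :: 'b \<times> 'b)"
  shows "st (w g) = Same"
proof (cases "snd (pphase g) = (0::'a) \<and> snd (lphase g) = (0::'b)")
  case False
  then show ?thesis using status_generic[OF w l] status_generic'[OF w l] U V by blast
next
  case True
  obtain x y z where g: "g = (x,y,z)" by (cases g) auto
  have 0: "(of_int y :: 'a) \<noteq> 0" "(of_int z :: 'a) = 0" "(of_int x :: 'b) \<noteq> 0" "(of_int (x*y-z) :: 'b) = 0"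
    using True U V by (auto simp: g prod_eq_iff)
  have R: "row (w (x,y',z)) = (of_int y', 0) \<and> st (w (x,y',z)) \<noteq> LineDeep" if y': "y' = y + 1 \<or> y' = y - 1" for y'
  proof -
    have v: "snd (lphase (x,y',z)) \<noteq> (0::'b)"
      using y' 0 by (auto simp: algebra_simps)
    show ?thesis
    proof (cases "(of_int y' :: 'a) = 0")
      case True
      then have "st (w (x,y',z)) = PointDeep"
        by (intro status_point_deep[OF w l]) (use v 0 in \<open>auto simp: prod_eq_iff\<close>)
      then show ?thesis using tile_PointDeep(1)[OF w] True by (auto simp: prod_eq_iff)
    next
      case False
      then have "st (w (x,y',z)) = Same" by (intro status_generic'[OF w l v]) (auto simp: prod_eq_iff)
      moreover have "ptl (w (x,y',z)) = (of_int y', 0)" using labelled_ptl[OF l, of "(x,y',z)"] False 0 by (auto simp: prod_eq_iff)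
      ultimately show ?thesis using tile_Same(3)[OF w] by auto
    qed
  qed
  have "row (w (x,y,z)) = (of_int y,0)" "st (w (x,y,z)) \<noteq> LineDeep"
    by (rule row_interpolate[OF w]; use R[of "y+1"] R[of "y-1"] in simp)+
  then show ?thesis using tile_PointDeep(1)[OF w, of "(x,y,z)"] 0(1)
    by (cases rule: status_cases[of "w (x,y,z)"]) (auto simp: g prod_eq_iff)
qed


section \<open>Self-similarity\<close>

definition pen_out :: "('a::field, 'b::field) tile \<Rightarrow> 'b \<times> 'b" where
  "pen_out T = (if st T = PointDeep then pen T else inc (pen T))"

definition row_out :: "('a::field, 'b::field) tile \<Rightarrow> 'a \<times> 'a" where
  "row_out T = (if st T = LineDeep then row T else inc (row T))"

lemma row_out_swap[simp]: "row_out (swap_tile T) = pen_out T" "pen_out (swap_tile T) = row_out T"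
  by (auto simp: row_out_def pen_out_def)

lemma tile_generic:
  fixes w :: "heis \<Rightarrow> ('a::field, 'b::field) tile"
  assumes w: "valid w" and l: "labelled w"
    and "pphase g \<noteq> (0 :: 'a \<times> 'a)" "lphase g \<noteq> (0 :: 'b \<times> 'b)"
  shows "w g = Tile Same (pphase g) (lphase g) (pphase g) (lphase g)"
  using status_same[OF assms] tile_Same[OF w status_same[OF assms]] labelled_ptl[OF l assms(3)]
    labelled_lnl[OF l assms(4)] by (simp add: tile.expand)

lemma tile_point_deep:
  fixes w :: "heis \<Rightarrow> ('a::field, 'b::field) tile"
  assumes w: "valid w" and l: "labelled w"
    and "pphase g = (0 :: 'a \<times> 'a)" "lphase g \<noteq> (0 :: 'b \<times> 'b)"
  shows "w g = Tile PointDeep (ptl (w g)) (lphase g) 0 (pen (w g))"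
  using status_point_deep[OF assms] tile_PointDeep[OF w status_point_deep[OF assms]]
    labelled_lnl[OF l assms(4)] by (simp add: tile.expand)

lemma tile_point_blank:
  fixes w :: "heis \<Rightarrow> ('a::field, 'b::field) tile"
  assumes w: "valid w" and l: "labelled w"
    and "pphase g = (0 :: 'a \<times> 'a)" "snd (lphase g) \<noteq> (0 :: 'b)"
  shows "w g = Tile PointDeep 0 (lphase g) 0 0"
proof -
  have ne: "lphase g \<noteq> (0 :: 'b \<times> 'b)" using assms(4) by (auto simp: prod_eq_iff)
  note t = tile_point_deep[OF w l assms(3) ne]
  have "st (w g) = PointDeep" "lnl (w g) = lphase g" by (subst t, simp)+
  then have "ptl (w g) = 0" "pen (w g) = 0"
    using tile_PointDeep(3,4)[OF w, of g] assms(4) by auto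
  then show ?thesis using t by simp
qed

lemma tile_line_blank:
  fixes w :: "heis \<Rightarrow> ('a::field, 'b::field) tile"
  assumes w: "valid w" and l: "labelled w"
    and "lphase g = (0 :: 'b \<times> 'b)" "snd (pphase g) \<noteq> (0 :: 'a)"
  shows "w g = Tile LineDeep (pphase g) 0 0 0"
proof -
  have "dual_conf w (dual g) = Tile PointDeep 0 (pphase g) 0 0"
    using tile_point_blank[OF valid_dual[OF w] labelled_dual[OF l], of "dual g"] assms by simp
  then have "w g = swap_tile (Tile PointDeep 0 (pphase g) 0 0)"
    by (metis dual_conf_def dual_dual swap_swap)
  then show ?thesis by (simp add: swap_tile_def)
qed

text \<open>Between two sublattice elements on an \<open>X\<close>-line every status is
  \<open>PointDeep\<close>, so the signal is handed on unchanged. The sublattice thus sees its own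
  signal at distance \<open>q\<close>.\<close>

lemma pen_pass:
  fixes w :: "heis \<Rightarrow> ('a::field, 'b::field) tile"
  assumes w: "valid w" and l: "labelled w"
    and U: "pphase (x,y,z) = (0 :: 'a \<times> 'a)" and V: "lphase (x,y,z) = (0 :: 'b \<times> 'b)"
    and k: "0 < k" "k \<le> CHAR('b)"
  shows "pen (w (x+int k, y, z+int k*y)) = pen_out (w (x,y,z))"
  using k
proof (induction k)
  case (Suc k)
  show ?case
  proof (cases "k = 0")
    case True
    then show ?thesis using valid_X(2)[OF w, of x y z] by (simp add: pen_out_def)
  next
    case False
    let ?g = "(x+int k, y, z+int k*y)"
    have "\<not> CHAR('b) dvd k" using Suc.prems False by (auto dest: dvd_imp_le)
    then have "(of_nat k :: 'b) \<noteq> 0" by (simp add: of_nat_eq_0_iff_char_dvd)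
    then have "st (w ?g) = PointDeep"
      by (intro status_point_deep[OF w l]) (use U V in \<open>auto simp: prod_eq_iff algebra_simps\<close>)
    moreover have "pen (w ?g) = pen_out (w (x,y,z))" using Suc False by simp
    moreover have eq: "(x+int (Suc k), y, z+int (Suc k)*y) = (x+int k+1, y, z+int k*y+y)"
      by (simp add: algebra_simps)
    ultimately show ?thesis unfolding eq valid_X(2)[OF w] by simp
  qed
qed simp

lemma X_segment:
  fixes w :: "heis \<Rightarrow> ('a::field, 'b::field) tile"
  assumes w: "valid w" and l: "labelled w"
    and U: "pphase (x,y,z) = (0 :: 'a \<times> 'a)" and V: "lphase (x,y,z) = (0 :: 'b \<times> 'b)"
    and k: "k \<noteq> 0" "\<bar>k\<bar> < int CHAR('b)"
  shows "w (x+k, y, z+k*y) = Tile PointDeep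
    (fst (ptl (w (x,y,z))), snd (ptl (w (x,y,z))) + of_int k * fst (ptl (w (x,y,z))))
    (of_int k, 0) 0 (if 0 < k then pen_out (w (x,y,z)) else pen (w (x,y,z)))"
proof -
  let ?q = "int CHAR('b)"
  have yz: "(of_int y :: 'a) = 0" "(of_int z :: 'a) = 0" "(of_int x :: 'b) = 0" "(of_int x * of_int y - of_int z :: 'b) = 0"
    using U V by (auto simp: prod_eq_iff)
  have "(of_int k :: 'b) \<noteq> 0" using of_int_inj_on_window[of k 0, where ?'a='b] k by auto
  then have "lphase (x+k, y, z+k*y) = (of_int k :: 'b, 0)" "lphase (x+k, y, z+k*y) \<noteq> (0 :: 'b \<times> 'b)"
    "pphase (x+k, y, z+k*y) = (0 :: 'a \<times> 'a)"
    using yz by (auto simp: prod_eq_iff algebra_simps)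
  note t = tile_point_deep[OF w l this(3,2)] and lp = this(1)
  have pn: "pen (w (x+k, y, z+k*y)) = (if 0 < k then pen_out (w (x,y,z)) else pen (w (x,y,z)))"
  proof (cases "0 < k")
    case True
    then show ?thesis using pen_pass[OF w l U V, of "nat k"] k by simp
  next
    case False
    \<comment> \<open>For negative \<open>k\<close> the signal was emitted by the preceding
      sublattice element and reaches both places unchanged.\<close>
    let ?x = "x - ?q" and ?z = "z - ?q * y"
    have "(of_int ?q :: 'b) = 0" by simp
    then have UV: "pphase (?x,y,?z) = (0 :: 'a \<times> 'a)" "lphase (?x,y,?z) = (0 :: 'b \<times> 'b)"
      using yz by (simp_all add: prod_eq_iff algebra_simps)
    have "pen (w (x, y, z)) = pen_out (w (?x,y,?z))"
      using pen_pass[OF w l UV, of "CHAR('b)"] k by auto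
    moreover have "(?x + int (nat (?q + k)), y, ?z + int (nat (?q + k)) * y) = (x+k,y,z+k*y)"
      using k by (simp add: algebra_simps)
    then have "pen (w (x+k,y,z+k*y)) = pen_out (w (?x,y,?z))"
      using pen_pass[OF w l UV, of "nat (?q + k)"] k False
      by (simp only:)
    ultimately show ?thesis using False by simp
  qed
  show ?thesis by (subst t) (simp only: lp pn ptl_X_iter[OF w, of x k y z])
qed

lemma Y_segment:
  fixes w :: "heis \<Rightarrow> ('a::field, 'b::field) tile"
  assumes w: "valid w" and l: "labelled w"
    and U: "pphase (x,y,z) = (0 :: 'a \<times> 'a)" and V: "lphase (x,y,z) = (0 :: 'b \<times> 'b)"
    and k: "k \<noteq> 0" "\<bar>k\<bar> < int CHAR('a)"
  shows "w (x, y+k, z) = Tile LineDeep (of_int k, 0)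
    (fst (lnl (w (x,y,z))), snd (lnl (w (x,y,z))) + of_int k * fst (lnl (w (x,y,z))))
    (if 0 < k then row_out (w (x,y,z)) else row (w (x,y,z))) 0"
proof -
  have "dual_conf w (y+k,x,x*y-z+k*x) = Tile PointDeep
    (fst (lnl (w (x,y,z))), snd (lnl (w (x,y,z))) + of_int k * fst (lnl (w (x,y,z))))
    (of_int k, 0) 0 (if 0 < k then row_out (w (x,y,z)) else row (w (x,y,z)))"
    by (subst X_segment[OF valid_dual[OF w] labelled_dual[OF l] _ _ k])
       (use U V in \<open>auto simp: dual_conf_def prod_eq_iff algebra_simps\<close>)
  moreover have "(y+k,x,x*y-z+k*x) = dual (x,y+k,z)" by (simp add: algebra_simps)
  ultimately have "w (x,y+k,z) = swap_tile (Tile PointDeep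
    (fst (lnl (w (x,y,z))), snd (lnl (w (x,y,z))) + of_int k * fst (lnl (w (x,y,z))))
    (of_int k, 0) 0 (if 0 < k then row_out (w (x,y,z)) else row (w (x,y,z))))"
    by (metis dual_conf_def dual_dual swap_swap)
  then show ?thesis by (simp add: swap_tile_def)
qed

text \<open>
  On the sublattice the generator \<open>X\<close> becomes \<open>X\<^sup>q\<close>, which shears a point label \<open>q\<close> times;
  dividing the second coordinate by \<open>q\<close> restores the original rule.
\<close>

definition scale :: "'a::times \<Rightarrow> 'a \<times> 'a \<Rightarrow> 'a \<times> 'a" where
  "scale c v = (fst v, c * snd v)"

lemma scale_sel[simp]: "fst (scale c v) = fst v" "snd (scale c v) = c * snd v" by (auto simp: scale_def)

lemma scale_eq_0[simp]: "c \<noteq> 0 \<Longrightarrow> scale c v = 0 \<longleftrightarrow> v = (0 :: 'a::field \<times> 'a)"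
  by (auto simp: prod_eq_iff)

lemma scale_inj[simp]: "c \<noteq> (0 :: 'a::field) \<Longrightarrow> scale c u = scale c v \<longleftrightarrow> u = v"
  by (auto simp: prod_eq_iff)

definition rescale :: "'a \<Rightarrow> 'b \<Rightarrow> ('a::times, 'b::times) tile \<Rightarrow> ('a, 'b) tile" where
  "rescale c d T = Tile (st T) (scale c (ptl T)) (scale d (lnl T)) (scale c (row T)) (scale d (pen T))"

lemma rescale_sel[simp]: "st (rescale c d T) = st T" "ptl (rescale c d T) = scale c (ptl T)"
  "lnl (rescale c d T) = scale d (lnl T)" "row (rescale c d T) = scale c (row T)"
  "pen (rescale c d T) = scale d (pen T)"
  by (auto simp: rescale_def)

lemma rescale_inj: "c \<noteq> 0 \<Longrightarrow> d \<noteq> 0 \<Longrightarrow> rescale c d S = rescale c d T \<longleftrightarrow> S = (T :: ('a::field,'b::field) tile)"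
  by (cases S; cases T) (auto simp: rescale_def)

lemma ok_tile_rescale: "c \<noteq> 0 \<Longrightarrow> d \<noteq> 0 \<Longrightarrow> ok_tile (rescale c d T) \<longleftrightarrow> ok_tile T"
  by (cases "st T") (auto simp: ok_tile_def)

definition dil :: "int \<Rightarrow> int \<Rightarrow> heis \<Rightarrow> heis" where
  "dil p q g = (case g of (x,y,z) \<Rightarrow> (q*x, p*y, p*q*z))"

lemma dil_simp[simp]: "dil p q (x,y,z) = (q*x, p*y, p*q*z)" by (simp add: dil_def)

lemma dil_hmul: "dil p q (hmul g h) = hmul (dil p q g) (dil p q h)"
  by (cases g; cases h) (simp add: algebra_simps)

lemma dil_dual: "dual (dil q p g) = dil p q (dual g)"
  by (cases g) (simp add: algebra_simps)

definition sub_conf :: "(heis \<Rightarrow> ('a::field, 'b::field) tile) \<Rightarrow> heis \<Rightarrow> ('a, 'b) tile" where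
  "sub_conf w h = rescale (inverse (of_nat CHAR('b))) (inverse (of_nat CHAR('a)))
     (w (dil (int CHAR('a)) (int CHAR('b)) h))"

lemma coprime_CHAR_units:
  assumes "coprime CHAR('a::field) CHAR('b::field)"
  shows "inverse (of_nat CHAR('b) :: 'a) \<noteq> 0" "inverse (of_nat CHAR('a) :: 'b) \<noteq> 0"
proof -
  have "\<not> CHAR('a) dvd CHAR('b)"
  proof
    assume "CHAR('a) dvd CHAR('b)"
    from coprime_absorb_left[OF this] assms have "CHAR('a) = Suc 0" by simp
    then show False by (simp only: CHAR_not_1')
  qed
  moreover have "\<not> CHAR('b) dvd CHAR('a)"
  proof
    assume "CHAR('b) dvd CHAR('a)"
    from coprime_absorb_right[OF this] assms have "CHAR('b) = Suc 0" by simp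
    then show False by (simp only: CHAR_not_1')
  qed
  ultimately show "inverse (of_nat CHAR('b) :: 'a) \<noteq> 0" "inverse (of_nat CHAR('a) :: 'b) \<noteq> 0"
    by (simp_all add: of_nat_eq_0_iff_char_dvd)
qed

lemma sub_conf_dual: "sub_conf (dual_conf w) = dual_conf (sub_conf w)"
  by (rule ext) (simp add: sub_conf_def dual_conf_def dil_dual swap_tile_def rescale_def)

lemma phases_dil[simp]:
  "pphase (dil (int CHAR('a::ring_1)) q h) = (0 :: 'a \<times> 'a)"
  "lphase (dil p (int CHAR('b::ring_1)) h) = (0 :: 'b \<times> 'b)"
proof -
  obtain x y z where h: "h = (x,y,z)" by (cases h) auto
  show "pphase (dil (int CHAR('a::ring_1)) q h) = (0 :: 'a \<times> 'a)"
    unfolding h dil_simp pphase_simp zero_prod_def prod.inject of_int_eq_0_iff_char_dvd by simp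
  have "int CHAR('b) dvd int CHAR('b) * x * (p * y) - p * int CHAR('b) * z"
    by (rule dvdI[of _ _ "x * p * y - p * z"]) (simp add: algebra_simps)
  then show "lphase (dil p (int CHAR('b::ring_1)) h) = (0 :: 'b \<times> 'b)"
    unfolding h dil_simp lphase_simp zero_prod_def prod.inject of_int_eq_0_iff_char_dvd by simp
qed

lemma sub_conf_X:
  fixes w :: "heis \<Rightarrow> ('a::field, 'b::field) tile"
  assumes w: "valid w" and l: "labelled w" and cop: "coprime CHAR('a) CHAR('b)" and pos: "0 < CHAR('b)"
  shows "ok_X (sub_conf w g) (sub_conf w (hmul (1,0,0) g))"
proof -
  let ?p = "int CHAR('a)" and ?q = "int CHAR('b)"
  obtain x y z where g: "g = (x,y,z)" by (cases g) auto
  let ?x = "?q*x" and ?y = "?p*y" and ?z = "?p*?q*z"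
  have eq: "dil ?p ?q (hmul (1,0,0) g) = (?x+?q, ?y, ?z+?q*?y)" by (simp add: g algebra_simps)
  have UV: "pphase (?x,?y,?z) = (0 :: 'a \<times> 'a)" "lphase (?x,?y,?z) = (0 :: 'b \<times> 'b)"
    using phases_dil(1)[of ?q g, where ?'a='a] phases_dil(2)[of ?p g, where ?'b='b] by (simp_all add: g)
  have "pen (w (?x+?q, ?y, ?z+?q*?y)) = pen_out (w (?x,?y,?z))"
    by (rule pen_pass[OF w l UV]) (use pos in auto)
  moreover have "ptl (w (?x+?q, ?y, ?z+?q*?y)) = (fst (ptl (w (?x,?y,?z))), snd (ptl (w (?x,?y,?z))) + of_int ?q * fst (ptl (w (?x,?y,?z))))"
    by (rule ptl_X_iter[OF w])
  ultimately show ?thesis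
    unfolding ok_X_def sub_conf_def eq rescale_sel using coprime_CHAR_units[OF cop]
    by (auto simp: g pen_out_def prod_eq_iff field_simps)
qed

lemma valid_sub_conf:
  fixes w :: "heis \<Rightarrow> ('a::field, 'b::field) tile"
  assumes w: "valid w" and l: "labelled w" and cop: "coprime CHAR('a) CHAR('b)"
    and pos: "0 < CHAR('a)" "0 < CHAR('b)"
  shows "valid (sub_conf w)"
  unfolding valid_def
proof (intro allI conjI)
  fix g :: heis
  show "ok_tile (sub_conf w g)"
    using valid_tile[OF w] coprime_CHAR_units[OF cop] by (simp add: sub_conf_def ok_tile_rescale)
  show "ok_X (sub_conf w g) (sub_conf w (hmul (1,0,0) g))" by (rule sub_conf_X[OF w l cop pos(2)])
  have "ok_X (dual_conf (sub_conf w) (dual g)) (dual_conf (sub_conf w) (hmul (1,0,0) (dual g)))"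
    using sub_conf_X[OF valid_dual[OF w] labelled_dual[OF l], of "dual g"] cop pos
    by (simp add: sub_conf_dual coprime_commute)
  moreover have "dual (hmul (1,0,0) (dual g)) = hmul (0,1,0) g"
    by (cases g) (simp add: algebra_simps)
  ultimately show "ok_Y (sub_conf w g) (sub_conf w (hmul (0,1,0) g))"
    by (simp add: dual_conf_def ok_X_def ok_Y_def)
qed

lemma sub_conf_shift:
  "sub_conf (\<lambda>h. w (hmul h (dil (int CHAR('a)) (int CHAR('b)) k))) =
   (\<lambda>h. sub_conf (w :: heis \<Rightarrow> ('a::field, 'b::field) tile) (hmul h k))"
  by (simp add: fun_eq_iff sub_conf_def dil_hmul)

lemma phases_shift_dil:
  "pphase (hmul g (dil (int CHAR('a)) q k)) = (pphase g :: 'a::ring_1 \<times> 'a)"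
  "lphase (hmul g (dil p (int CHAR('b)) k)) = (lphase g :: 'b::ring_1 \<times> 'b)"
proof -
  obtain x y z where g: "g = (x,y,z)" by (cases g) auto
  obtain a b c where k: "k = (a,b,c)" by (cases k) auto
  let ?p = "int CHAR('a)" and ?q = "int CHAR('b)"
  have "?p dvd y + ?p * b - y" "?p dvd z + ?p * q * c + x * (?p * b) - z"
    by (rule dvdI[of _ _ b] dvdI[of _ _ "q * c + x * b"], simp add: algebra_simps)+
  then show "pphase (hmul g (dil ?p q k)) = (pphase g :: 'a::ring_1 \<times> 'a)"
    unfolding g k dil_simp hmul_simp pphase_simp prod.inject of_int_eq_iff_CHAR_dvd by blast
  have "?q dvd x + ?q * a - x" "?q dvd (x + ?q * a) * (y + p * b) - (z + p * ?q * c + x * (p * b)) - (x * y - z)"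
    by (rule dvdI[of _ _ a] dvdI[of _ _ "a * (y + p * b) - p * c"], simp add: algebra_simps)+
  then show "lphase (hmul g (dil p ?q k)) = (lphase g :: 'b::ring_1 \<times> 'b)"
    unfolding g k dil_simp hmul_simp lphase_simp prod.inject of_int_eq_iff_CHAR_dvd by blast
qed

lemma labelled_shift_dil:
  fixes w :: "heis \<Rightarrow> ('a::field, 'b::field) tile"
  assumes "labelled w"
  shows "labelled (\<lambda>h. w (hmul h (dil (int CHAR('a)) (int CHAR('b)) k)))"
  using assms unfolding labelled_def by (metis phases_shift_dil)

section \<open>Strong aperiodicity\<close>

definition hinv :: "heis \<Rightarrow> heis" where
  "hinv g = (case g of (x,y,z) \<Rightarrow> (-x, -y, x*y-z))"

lemma hinv_simp[simp]: "hinv (x,y,z) = (-x,-y,x*y-z)" by (simp add: hinv_def)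

lemma hmul_hinv[simp]: "hmul g (hinv g) = hone" "hmul (hinv g) g = hone"
  by (cases g; simp add: hone_def algebra_simps)+

lemma hmul_hone[simp]: "hmul g hone = g" "hmul hone g = g"
  by (cases g; simp add: hone_def)+

text \<open>A tile at an element with both phases nonzero reveals both phases. The element
  \<open>?h\<close> is chosen so that it and its translate by \<open>g\<close> are both of this
  kind; equality of phases then puts \<open>g\<close> into the sublattice.\<close>

lemma labelled_period_dil:
  fixes w :: "heis \<Rightarrow> ('a::large_prime_field, 'b::large_prime_field) tile"
  assumes w: "valid w" and l: "labelled w" and cop: "coprime CHAR('a) CHAR('b)"
    and per: "\<And>h. w (hmul h g) = w h"
  shows "\<exists>k. g = dil (int CHAR('a)) (int CHAR('b)) k"
proof -
  obtain a b c where g: "g = (a,b,c)" by (cases g) auto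
  have "\<exists>v\<in>{0..<8::int}. \<forall>P\<in>set [\<lambda>v. (of_int v :: 'a) = 0, \<lambda>v. (of_int v :: 'a) = - of_int b]. \<not> P v"
    by (rule ex_int_avoiding_all) (use window_unique[where ?'a='a] in force)+
  then obtain y where y: "(of_int y :: 'a) \<noteq> 0" "(of_int y :: 'a) \<noteq> - of_int b" by auto
  have "\<exists>v\<in>{0..<8::int}. \<forall>P\<in>set [\<lambda>v. (of_int v :: 'b) = 0, \<lambda>v. (of_int v :: 'b) = - of_int a]. \<not> P v"
    by (rule ex_int_avoiding_all) (use window_unique[where ?'a='b] in force)+
  then obtain x where x: "(of_int x :: 'b) \<noteq> 0" "(of_int x :: 'b) \<noteq> - of_int a" by auto
  let ?h = "(x,y,0)"
  have ph: "pphase ?h \<noteq> (0 :: 'a \<times> 'a)" "lphase ?h \<noteq> (0 :: 'b \<times> 'b)"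
    using x y by (auto simp: prod_eq_iff)
  have ph': "pphase (hmul ?h g) \<noteq> (0 :: 'a \<times> 'a)" "lphase (hmul ?h g) \<noteq> (0 :: 'b \<times> 'b)"
    using x y by (auto simp: prod_eq_iff g eq_neg_iff_add_eq_0)
  have e: "pphase (hmul ?h g) = (pphase ?h :: 'a \<times> 'a)" "lphase (hmul ?h g) = (lphase ?h :: 'b \<times> 'b)"
    using tile_generic[OF w l ph] tile_generic[OF w l ph'] per[of ?h] by auto
  have b0: "(of_int b :: 'a) = 0" and a0: "(of_int a :: 'b) = 0" using e by (auto simp: g prod_eq_iff)
  have c0: "(of_int c :: 'a) = 0" using e(1) b0 by (simp add: g prod_eq_iff)
  have c1: "(of_int c :: 'b) = 0" using e(2) a0 by (simp add: g prod_eq_iff algebra_simps)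
  have "int CHAR('a) dvd b" "int CHAR('b) dvd a" "int CHAR('a) dvd c" "int CHAR('b) dvd c"
    using a0 b0 c0 c1 by (simp_all add: of_int_eq_0_iff_char_dvd)
  moreover then have "int CHAR('a) * int CHAR('b) dvd c"
    using cop by (intro divides_mult) auto
  ultimately obtain a' b' c' where "a = int CHAR('b) * a'" "b = int CHAR('a) * b'" "c = int CHAR('a) * int CHAR('b) * c'"
    by (auto elim!: dvdE)
  then show ?thesis by (intro exI[of _ "(a',b',c')"]) (simp add: g)
qed

text \<open>Centring conjugates the period. This keeps \<open>a\<close> and \<open>b\<close> but
  adds an integral combination of them to \<open>c\<close>, so the divisibility of \<open>c\<close>
  is claimed only for \<open>a = b = 0\<close>.\<close>

lemma period_descent:
  fixes w :: "heis \<Rightarrow> ('a::large_prime_field, 'b::large_prime_field) tile"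
  assumes w: "valid w" and cop: "coprime CHAR('a) CHAR('b)"
    and per: "\<And>h. w (hmul h (a,b,c)) = w h"
  shows "\<exists>(w' :: heis \<Rightarrow> ('a, 'b) tile) a' b' c'. valid w' \<and> (\<forall>h. w' (hmul h (a',b',c')) = w' h) \<and>
    a = int CHAR('b) * a' \<and> b = int CHAR('a) * b' \<and>
    (a = 0 \<longrightarrow> b = 0 \<longrightarrow> c = int CHAR('a) * int CHAR('b) * c')"
proof -
  obtain g0 where l: "labelled (\<lambda>h. w (hmul h g0))" using ex_labelled_shift[OF w cop] by auto
  let ?u = "\<lambda>h. w (hmul h g0)"
  let ?g = "hmul g0 (hmul (a,b,c) (hinv g0))"
  note vu = valid_shift[OF w, of g0]
  have peru: "?u (hmul h ?g) = ?u h" for h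
    using per[of "hmul h g0"] by (simp add: hmul_assoc)
  obtain k where k: "?g = dil (int CHAR('a)) (int CHAR('b)) k"
    using labelled_period_dil[OF vu l cop] peru by blast
  obtain a' b' c' where k': "k = (a',b',c')" by (cases k) auto
  obtain x y z where g0: "g0 = (x,y,z)" by (cases g0) auto
  have pos: "0 < CHAR('a)" "0 < CHAR('b)" using CHAR_large[where ?'a='a] CHAR_large[where ?'a='b] by auto
  have perk: "sub_conf ?u (hmul h (a',b',c')) = sub_conf ?u h" for h
  proof -
    have "sub_conf ?u (hmul h k) = sub_conf (\<lambda>h. ?u (hmul h ?g)) h"
      unfolding k by (rule fun_cong[OF sub_conf_shift[symmetric]])
    then show ?thesis unfolding peru k' .
  qed
  show ?thesis
    by (rule exI[of _ "sub_conf ?u"], rule exI[of _ a'], rule exI[of _ b'], rule exI[of _ c'],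
        intro conjI allI valid_sub_conf[OF vu l cop pos] perk)
       (use k in \<open>auto simp: g0 k' algebra_simps\<close>)
qed

lemma period_dvd:
  fixes w :: "heis \<Rightarrow> ('a::large_prime_field, 'b::large_prime_field) tile"
  assumes w: "valid w" and cop: "coprime CHAR('a) CHAR('b)"
    and per: "\<And>h. w (hmul h (a,b,c)) = w h"
  shows "int CHAR('b) ^ n dvd a \<and> int CHAR('a) ^ n dvd b \<and>
    (a = 0 \<longrightarrow> b = 0 \<longrightarrow> (int CHAR('a) * int CHAR('b)) ^ n dvd c)"
  using w per
proof (induction n arbitrary: w a b c)
  case (Suc n)
  obtain w' :: "heis \<Rightarrow> ('a, 'b) tile" and a' b' c' where *: "valid w'" "\<forall>h. w' (hmul h (a',b',c')) = w' h"
    "a = int CHAR('b) * a'" "b = int CHAR('a) * b'" "a = 0 \<longrightarrow> b = 0 \<longrightarrow> c = int CHAR('a) * int CHAR('b) * c'"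
    using period_descent[OF Suc.prems(1) cop Suc.prems(2)] by blast
  have pos: "0 < CHAR('a)" "0 < CHAR('b)" using CHAR_large[where ?'a='a] CHAR_large[where ?'a='b] by auto
  show ?case
    using Suc.IH[OF *(1) *(2)[rule_format]] *(3-5) pos by (auto intro: mult_dvd_mono)
qed simp

lemma power_dvd_imp_zero:
  fixes a b :: int
  assumes "\<And>n. b ^ n dvd a" "1 < b"
  shows "a = 0"
proof (rule ccontr)
  assume "a \<noteq> 0"
  then have "\<bar>b ^ nat \<bar>a\<bar>\<bar> \<le> \<bar>a\<bar>" by (rule dvd_imp_le_int) (rule assms(1))
  moreover have "\<bar>a\<bar> < b ^ nat \<bar>a\<bar>"
  proof -
    have "int m < b ^ m" for m
    proof (induction m)
      case (Suc m)
      have "2 * b ^ m \<le> b * b ^ m" using \<open>1 < b\<close> by (intro mult_right_mono) auto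
      then show ?case using Suc unfolding of_nat_Suc power_Suc by linarith
    qed simp
    from this[of "nat \<bar>a\<bar>"] show ?thesis by simp
  qed
  ultimately show False by linarith
qed

lemma valid_no_period:
  fixes w :: "heis \<Rightarrow> ('a::large_prime_field, 'b::large_prime_field) tile"
  assumes w: "valid w" and cop: "coprime CHAR('a) CHAR('b)"
    and per: "\<And>h. w (hmul h g) = w h"
  shows "g = hone"
proof -
  obtain a b c where g: "g = (a,b,c)" by (cases g) auto
  have C: "11 \<le> int CHAR('a)" "11 \<le> int CHAR('b)" using CHAR_large[where ?'a='a] CHAR_large[where ?'a='b] by auto
  have "1 * 1 < int CHAR('a) * int CHAR('b)" by (rule mult_strict_mono) (use C in auto)
  note d = period_dvd[OF w cop per[unfolded g]]
  have "a = 0" by (rule power_dvd_imp_zero[of "int CHAR('b)"]) (use d C in auto)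
  moreover have "b = 0" by (rule power_dvd_imp_zero[of "int CHAR('a)"]) (use d C in auto)
  moreover have "c = 0" if "a = 0" "b = 0"
    by (rule power_dvd_imp_zero[of "int CHAR('a) * int CHAR('b)"])
       (use d that \<open>1 * 1 < int CHAR('a) * int CHAR('b)\<close> in auto)
  ultimately show ?thesis by (simp add: g hone_def)
qed


section \<open>Minimality\<close>

lemma ex_phases:
  fixes u :: "'a::large_prime_field \<times> 'a" and v :: "'b::large_prime_field \<times> 'b"
  assumes cop: "coprime CHAR('a) CHAR('b)"
  shows "\<exists>g. pphase g = u \<and> lphase g = v"
proof -
  obtain y z1 where u: "u = (of_int y, of_int z1)"
    using ex_of_int[of "fst u"] ex_of_int[of "snd u"] by (auto simp: prod_eq_iff)
  obtain x z2 where v: "v = (of_int x, of_int z2)"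
    using ex_of_int[of "fst v"] ex_of_int[of "snd v"] by (auto simp: prod_eq_iff)
  obtain z where z: "int CHAR('a) dvd z - z1" "int CHAR('b) dvd z - (x*y-z2)"
    using crt_int[of "int CHAR('a)" "int CHAR('b)"] cop by (metis coprime_int_iff)
  have "(of_int z :: 'a) = of_int z1" "(of_int z :: 'b) = of_int (x*y-z2)"
    using z by (simp_all only: of_int_eq_iff_CHAR_dvd)
  then show ?thesis by (intro exI[of _ "(x,y,z)"]) (simp add: u v)
qed

lemma ex_of_int_window:
  assumes "(j :: 'b::large_prime_field) \<noteq> 0"
  shows "\<exists>k. 0 < k \<and> k < int CHAR('b) \<and> of_int k = j"
proof -
  obtain l where l: "j = of_int l" using ex_of_int by metis
  have pos: "0 < int CHAR('b)" using CHAR_large[where ?'a='b] by simp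
  have "int CHAR('b) dvd l mod int CHAR('b) - l" by (simp add: mod_eq_dvd_iff[symmetric])
  then have e: "(of_int (l mod int CHAR('b)) :: 'b) = of_int l" by (simp only: of_int_eq_iff_CHAR_dvd)
  then have "l mod int CHAR('b) \<noteq> 0" using assms l by (metis of_int_0)
  then have "0 < l mod int CHAR('b)" using pos_mod_sign[OF pos, of l] by linarith
  then show ?thesis using pos_mod_bound[OF pos, of l] e l by metis
qed

lemma same_tile_occurs:
  fixes w :: "heis \<Rightarrow> ('a::large_prime_field, 'b::large_prime_field) tile"
  assumes w: "valid w" and cop: "coprime CHAR('a) CHAR('b)" and "a \<noteq> 0" "b \<noteq> 0"
  shows "\<exists>g. w g = Tile Same a b a b"
proof -
  obtain g0 where l: "labelled (\<lambda>h. w (hmul h g0))" using ex_labelled_shift[OF w cop] by auto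
  obtain g where g: "pphase g = a" "lphase g = b" using ex_phases[OF cop] by blast
  show ?thesis using tile_generic[OF valid_shift[OF w] l, of g] g assms(3,4) by blast
qed

lemma blank_tile_occurs:
  fixes w :: "heis \<Rightarrow> ('a::large_prime_field, 'b::large_prime_field) tile"
  assumes w: "valid w" and cop: "coprime CHAR('a) CHAR('b)" and "snd b \<noteq> 0"
  shows "\<exists>g. w g = Tile PointDeep 0 b 0 0"
proof -
  obtain g0 where l: "labelled (\<lambda>h. w (hmul h g0))" using ex_labelled_shift[OF w cop] by auto
  obtain g where g: "pphase g = (0 :: 'a \<times> 'a)" "lphase g = b" using ex_phases[OF cop] by blast
  show ?thesis using tile_point_blank[OF valid_shift[OF w] l, of g] g assms(3) by blast
qed

text \<open>First-level phases give these tiles when \<open>snd b\<close> is nonzero. The others are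
  found on an \<open>X\<close>-line beside a sublattice element whose own tile is prescribed by
  applying the previous results to \<open>sub_conf\<close>.\<close>

lemma point_deep_tile_occurs:
  fixes w :: "heis \<Rightarrow> ('a::large_prime_field, 'b::large_prime_field) tile"
  assumes w: "valid w" and cop: "coprime CHAR('a) CHAR('b)" and T: "ok_tile T" "st T = PointDeep"
  shows "\<exists>g. w g = T"
proof -
  obtain g0 where l: "labelled (\<lambda>h. w (hmul h g0))" using ex_labelled_shift[OF w cop] by auto
  let ?u = "\<lambda>h. w (hmul h g0)"
  let ?dil = "dil (int CHAR('a)) (int CHAR('b))"
  let ?c = "inverse (of_nat CHAR('b)) :: 'a" and ?d = "inverse (of_nat CHAR('a)) :: 'b"
  note u = valid_shift[OF w, of g0]
  have pos: "0 < CHAR('a)" "0 < CHAR('b)" using CHAR_large[where ?'a='a] CHAR_large[where ?'a='b] by auto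
  have cd: "?c \<noteq> 0" "?d \<noteq> 0" by (rule coprime_CHAR_units[OF cop])+
  note vs = valid_sub_conf[OF u l cop pos]
  have seg: "?u (x+k, y, z+k*y) = Tile PointDeep
      (fst (ptl (?u (x,y,z))), snd (ptl (?u (x,y,z))) + of_int k * fst (ptl (?u (x,y,z))))
      (of_int k, 0) 0 (if 0 < k then pen_out (?u (x,y,z)) else pen (?u (x,y,z)))"
    if "?dil h = (x,y,z)" "k \<noteq> 0" "\<bar>k\<bar> < int CHAR('b)" for h x y z k
    by (rule X_segment[OF u l _ _ that(2,3)]) (use phases_dil that(1) in metis)+
  obtain a b t where Teq: "T = Tile PointDeep a b 0 t" and b: "b \<noteq> 0"
    and ab: "a = 0 \<and> t = 0 \<or> a \<noteq> 0 \<and> snd b = 0"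
    using T by (cases T) (auto simp: ok_tile_def)
  have "\<exists>g. ?u g = T"
  proof (cases "snd b = 0")
    case False
    then show ?thesis using blank_tile_occurs[OF u cop, of b] ab Teq by auto
  next
    case True
    then obtain j where j: "b = (j,0)" "j \<noteq> 0" using b by (cases b) (auto simp: prod_eq_iff)
    consider "a = 0" "t = 0" | "a \<noteq> 0" "t = 0" | "a \<noteq> 0" "t \<noteq> 0" using ab by blast
    then show ?thesis
    proof cases
      case 1
      obtain h where "sub_conf ?u h = Tile PointDeep 0 (0,1) 0 0" using blank_tile_occurs[OF vs cop, of "(0,1)"] by auto
      then have "scale ?c (ptl (?u (?dil h))) = 0" unfolding sub_conf_def by (metis rescale_sel(2) tile.sel(2))
      then have p0: "ptl (?u (?dil h)) = 0" using cd by simp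
      obtain x y z where h: "?dil h = (x,y,z)" by (cases "?dil h") auto
      obtain k where k: "0 < k" "k < int CHAR('b)" "of_int k = j" using ex_of_int_window[OF j(2)] by auto
      have "?u (x+k,y,z+k*y) = Tile PointDeep 0 b 0 (pen_out (?u (x,y,z)))"
        using seg[OF h, of k] k p0 j unfolding h by (simp add: prod_eq_iff)
      moreover from this have "pen (?u (x+k,y,z+k*y)) = 0"
        using tile_PointDeep(3)[OF u, of "(x+k,y,z+k*y)"] by simp
      ultimately show ?thesis using Teq 1 by auto
    next
      \<comment> \<open>A \<open>Same\<close> tile cannot carry the signal 0, but it emits 0 to its
        right when its \<open>pen\<close> is \<open>(-1,0)\<close>. The label is sheared back by the
        offset \<open>k\<close>.\<close>
      case 2
      obtain k where k: "0 < k" "k < int CHAR('b)" "of_int k = j" using ex_of_int_window[OF j(2)] by auto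
      let ?a = "(fst a, snd a - of_int k * fst a)"
      have "?a \<noteq> 0" using 2 by (auto simp: prod_eq_iff)
      then obtain h where "sub_conf ?u h = Tile Same (scale ?c ?a) (scale ?d (-1,0)) (scale ?c ?a) (scale ?d (-1,0))"
        using same_tile_occurs[OF vs cop, of "scale ?c ?a" "scale ?d (-1,0)"] cd by (auto simp: prod_eq_iff)
      also have "\<dots> = rescale ?c ?d (Tile Same ?a (-1,0) ?a (-1,0))" by (simp add: rescale_def)
      finally have e: "?u (?dil h) = Tile Same ?a (-1,0) ?a (-1,0)" unfolding sub_conf_def using rescale_inj[OF cd] by blast
      obtain x y z where h: "?dil h = (x,y,z)" by (cases "?dil h") auto
      have "?u (x+k,y,z+k*y) = T"
        using seg[OF h, of k] k e j 2 unfolding h by (simp add: pen_out_def inc_def Teq zero_prod_def prod_eq_iff)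
      then show ?thesis by blast
    next
      \<comment> \<open>A nonzero signal is read off to the left of the sublattice element, where it
        equals the \<open>pen\<close> of that element; hence the offset \<open>-k\<close>.\<close>
      case 3
      obtain k where k: "0 < k" "k < int CHAR('b)" "of_int k = -j" using ex_of_int_window[of "-j"] j by auto
      let ?a = "(fst a, snd a + of_int k * fst a)"
      have "?a \<noteq> 0" using 3 by (auto simp: prod_eq_iff)
      then obtain h where "sub_conf ?u h = Tile Same (scale ?c ?a) (scale ?d t) (scale ?c ?a) (scale ?d t)"
        using same_tile_occurs[OF vs cop, of "scale ?c ?a" "scale ?d t"] cd 3 by auto
      also have "\<dots> = rescale ?c ?d (Tile Same ?a t ?a t)" by (simp add: rescale_def)
      finally have e: "?u (?dil h) = Tile Same ?a t ?a t" unfolding sub_conf_def using rescale_inj[OF cd] by blast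
      obtain x y z where h: "?dil h = (x,y,z)" by (cases "?dil h") auto
      have "?u (x+(-k),y,z+(-k)*y) = T"
        using seg[OF h, of "-k"] k e j unfolding h by (simp add: Teq)
      then show ?thesis by blast
    qed
  qed
  then show ?thesis by blast
qed

lemma tile_occurs:
  fixes w :: "heis \<Rightarrow> ('a::large_prime_field, 'b::large_prime_field) tile"
  assumes w: "valid w" and cop: "coprime CHAR('a) CHAR('b)" and T: "ok_tile T"
  shows "\<exists>g. w g = T"
proof (cases rule: status_cases[of T])
  case 1
  then show ?thesis using same_tile_occurs[OF w cop, of "ptl T" "lnl T"] T by (cases T) (auto simp: ok_tile_def)
next
  case 2
  then show ?thesis using point_deep_tile_occurs[OF w cop T] by blast
next
  case 3
  have "\<exists>g. dual_conf w g = swap_tile T"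
    by (rule point_deep_tile_occurs[OF valid_dual[OF w]]) (use cop T 3 in \<open>auto simp: ok_tile_swap coprime_commute\<close>)
  then show ?thesis unfolding dual_conf_def by (metis swap_swap)
qed

text \<open>
  The tiles of a labelled configuration are determined by the phases except at the special elements,
  whose tiles are determined by one tile of the sublattice near them.
\<close>

definition special :: "int \<Rightarrow> int \<Rightarrow> heis \<Rightarrow> bool" where
  "special p q g \<longleftrightarrow> (case g of (x,y,z) \<Rightarrow> p dvd z \<and> q dvd x*y - z \<and> (p dvd y \<or> q dvd x))"

definition near :: "int \<Rightarrow> int \<Rightarrow> heis \<Rightarrow> heis \<Rightarrow> bool" where
  "near p q g h \<longleftrightarrow> (case g of (x,y,z) \<Rightarrow>
     (\<exists>k. \<bar>k\<bar> < q \<and> h = (x+k, y, z+k*y)) \<or> (\<exists>k. \<bar>k\<bar> < p \<and> h = (x, y+k, z)))"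

lemma agree_not_special:
  fixes w w' :: "heis \<Rightarrow> ('a::field, 'b::field) tile"
  assumes "valid w" "labelled w" "valid w'" "labelled w'" "\<not> special (int CHAR('a)) (int CHAR('b)) g"
  shows "w g = w' g"
proof -
  obtain x y z where g: "g = (x,y,z)" by (cases g) auto
  have "(pphase g \<noteq> (0 :: 'a \<times> 'a) \<and> lphase g \<noteq> (0 :: 'b \<times> 'b)) \<or>
    (pphase g = (0 :: 'a \<times> 'a) \<and> snd (lphase g) \<noteq> (0 :: 'b)) \<or>
    (lphase g = (0 :: 'b \<times> 'b) \<and> snd (pphase g) \<noteq> (0 :: 'a))"
    using assms(5) unfolding g special_def pphase_simp lphase_simp zero_prod_def prod.inject snd_conv
      of_int_eq_0_iff_char_dvd by auto
  then show ?thesis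
    using tile_generic[OF assms(1,2), of g] tile_generic[OF assms(3,4), of g]
      tile_point_blank[OF assms(1,2), of g] tile_point_blank[OF assms(3,4), of g]
      tile_line_blank[OF assms(1,2), of g] tile_line_blank[OF assms(3,4), of g] by metis
qed

lemma agree_near:
  fixes w w' :: "heis \<Rightarrow> ('a::field, 'b::field) tile"
  assumes "valid w" "labelled w" "valid w'" "labelled w'"
    and e: "w (dil (int CHAR('a)) (int CHAR('b)) k) = w' (dil (int CHAR('a)) (int CHAR('b)) k)"
    and n: "near (int CHAR('a)) (int CHAR('b)) (dil (int CHAR('a)) (int CHAR('b)) k) g"
  shows "w g = w' g"
proof -
  obtain x y z where d: "dil (int CHAR('a)) (int CHAR('b)) k = (x,y,z)"
    by (cases "dil (int CHAR('a)) (int CHAR('b)) k") auto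
  have U: "pphase (x,y,z) = (0 :: 'a \<times> 'a)" and V: "lphase (x,y,z) = (0 :: 'b \<times> 'b)"
    unfolding d[symmetric] by simp_all
  have e': "w (x,y,z) = w' (x,y,z)" using e by (simp add: d)
  from n consider i where "\<bar>i\<bar> < int CHAR('b)" "g = (x+i, y, z+i*y)" | i where "\<bar>i\<bar> < int CHAR('a)" "g = (x, y+i, z)"
    unfolding near_def d by auto
  then show ?thesis
  proof cases
    case 1
    then show ?thesis
      using X_segment[OF assms(1,2) U V, of i] X_segment[OF assms(3,4) U V, of i] e' by (cases "i = 0") simp_all
  next
    case 2
    then show ?thesis
      using Y_segment[OF assms(1,2) U V, of i] Y_segment[OF assms(3,4) U V, of i] e' by (cases "i = 0") simp_all
  qed
qed

section \<open>Transfer of finite patterns from level to level\<close>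

definition common_patterns :: "('a::field, 'b::field) tile itself \<Rightarrow> heis set \<Rightarrow> bool" where
  "common_patterns TY F \<longleftrightarrow> (\<forall>(w :: heis \<Rightarrow> ('a,'b) tile) w'. valid w \<longrightarrow> valid w' \<longrightarrow>
     (\<exists>g. \<forall>h\<in>F. w' (hmul h g) = w h))"

lemma common_patterns_single:
  assumes "coprime CHAR('a::large_prime_field) CHAR('b::large_prime_field)"
  shows "common_patterns TYPE(('a,'b) tile) {k}"
  unfolding common_patterns_def
proof (intro allI impI)
  fix w w' :: "heis \<Rightarrow> ('a,'b) tile"
  assume "valid w" "valid w'"
  then obtain g where "w' g = w k" using tile_occurs[of w' "w k"] valid_tile assms by metis
  then have "w' (hmul k (hmul (hinv k) g)) = w k" by (simp add: hmul_assoc[symmetric])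
  then show "\<exists>g. \<forall>h\<in>{k}. w' (hmul h g) = w h" by blast
qed

text \<open>A centring element may be multiplied by the sublattice, so its inverse can be moved into
  a fundamental domain. These bounds are what makes boxes shrink under passage to the
  sublattice.\<close>

lemma ex_small_labelled_shift:
  fixes w :: "heis \<Rightarrow> ('a::large_prime_field, 'b::large_prime_field) tile"
  assumes w: "valid w" and cop: "coprime CHAR('a) CHAR('b)"
  shows "\<exists>a b c. 0 \<le> a \<and> a < int CHAR('b) \<and> 0 \<le> b \<and> b < int CHAR('a) \<and> 0 \<le> c \<and> c < int CHAR('a) * int CHAR('b) \<and>
    labelled (\<lambda>h. w (hmul h (hinv (a,b,c))))"
proof -
  let ?p = "int CHAR('a)" and ?q = "int CHAR('b)"
  obtain g0 where l: "labelled (\<lambda>h. w (hmul h g0))" using ex_labelled_shift[OF w cop] by auto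
  have pos: "0 < ?p" "0 < ?q" using CHAR_large[where ?'a='a] CHAR_large[where ?'a='b] by auto
  then have pq: "0 < ?p * ?q" by simp
  obtain x y z where m: "hinv g0 = (x,y,z)" by (cases "hinv g0") auto
  define A B where "A = x div ?q" and "B = y div ?p"
  define C where "C = (z - x * (?p * B)) div (?p * ?q)"
  define a b c where "a = x - ?q * A" and "b = y - ?p * B" and "c = z - x * (?p * B) - (?p * ?q) * C"
  let ?k = "(-A, -B, -C)"
  have "hmul (hinv g0) (dil ?p ?q ?k) = (a,b,c)"
    by (simp add: m a_def b_def c_def algebra_simps)
  moreover have "hinv (hmul (hinv g0) (dil ?p ?q ?k)) = hmul (dil ?p ?q (hinv ?k)) g0"
    by (cases g0) (simp add: algebra_simps)
  moreover have "labelled (\<lambda>h. w (hmul h (hmul (dil ?p ?q (hinv ?k)) g0)))"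
    using labelled_shift_dil[OF l, of "hinv ?k"] by (simp only: hmul_assoc)
  ultimately have "labelled (\<lambda>h. w (hmul h (hinv (a,b,c))))" by (simp only:)
  moreover have "a = x mod ?q" "b = y mod ?p" "c = (z - x * (?p * B)) mod (?p * ?q)"
    unfolding a_def b_def c_def A_def B_def C_def by (rule minus_mult_div_eq_mod)+
  then have "0 \<le> a" "a < ?q" "0 \<le> b" "b < ?p" "0 \<le> c" "c < ?p * ?q"
    using pos_mod_bound[OF pos(1)] pos_mod_sign[OF pos(1)] pos_mod_bound[OF pos(2)] pos_mod_sign[OF pos(2)]
      pos_mod_bound[OF pq] pos_mod_sign[OF pq] by auto
  ultimately show ?thesis by blast
qed

text \<open>Once centred, any two configurations agree off the special elements. A sublattice shift
  preserves centring and can match the second levels on \<open>F'\<close>, which settles the special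
  elements near the image of \<open>F'\<close>.\<close>

lemma common_patterns_step:
  assumes cop: "coprime CHAR('a::large_prime_field) CHAR('b::large_prime_field)"
    and F: "\<And>a b c. 0 \<le> a \<Longrightarrow> a < int CHAR('b) \<Longrightarrow> 0 \<le> b \<Longrightarrow> b < int CHAR('a) \<Longrightarrow> 0 \<le> c \<Longrightarrow> c < int CHAR('a) * int CHAR('b) \<Longrightarrow>
      \<exists>F'. common_patterns TYPE(('a,'b) tile) F' \<and> (\<forall>h\<in>F. special (int CHAR('a)) (int CHAR('b)) (hmul h (a,b,c)) \<longrightarrow>
        (\<exists>k\<in>F'. near (int CHAR('a)) (int CHAR('b)) (dil (int CHAR('a)) (int CHAR('b)) k) (hmul h (a,b,c))))"
  shows "common_patterns TYPE(('a,'b) tile) F"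
  unfolding common_patterns_def
proof (intro allI impI)
  let ?p = "int CHAR('a)" and ?q = "int CHAR('b)"
  fix w w' :: "heis \<Rightarrow> ('a,'b) tile"
  assume w: "valid w" and w': "valid w'"
  obtain a b c where abc: "0 \<le> a" "a < ?q" "0 \<le> b" "b < ?p" "0 \<le> c" "c < ?p * ?q"
    and l: "labelled (\<lambda>h. w (hmul h (hinv (a,b,c))))"
    using ex_small_labelled_shift[OF w cop] by blast
  obtain g0 where l': "labelled (\<lambda>h. w' (hmul h g0))" using ex_labelled_shift[OF w' cop] by auto
  obtain F' where F': "common_patterns TYPE(('a,'b) tile) F'"
    and near: "\<And>h. h \<in> F \<Longrightarrow> special ?p ?q (hmul h (a,b,c)) \<Longrightarrow> \<exists>k\<in>F'. near ?p ?q (dil ?p ?q k) (hmul h (a,b,c))"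
    using F[OF abc] by blast
  let ?m = "(a,b,c)"
  let ?u = "\<lambda>h. w (hmul h (hinv ?m))" and ?u' = "\<lambda>h. w' (hmul h g0)"
  note u = valid_shift[OF w, of "hinv ?m"] and u' = valid_shift[OF w', of g0]
  have pos: "0 < CHAR('a)" "0 < CHAR('b)" using CHAR_large[where ?'a='a] CHAR_large[where ?'a='b] by auto
  obtain k where k: "\<And>h. h \<in> F' \<Longrightarrow> sub_conf ?u' (hmul h k) = sub_conf ?u h"
    using F' valid_sub_conf[OF u l cop pos] valid_sub_conf[OF u' l' cop pos] unfolding common_patterns_def by blast
  let ?v = "\<lambda>h. ?u' (hmul h (dil ?p ?q k))"
  have v: "valid ?v" by (rule valid_shift[OF u'])
  have lv: "labelled ?v" by (rule labelled_shift_dil[OF l'])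
  have ag: "?v (dil ?p ?q h) = ?u (dil ?p ?q h)" if "h \<in> F'" for h
  proof -
    have "sub_conf ?v h = sub_conf ?u h" by (rule trans[OF fun_cong[OF sub_conf_shift[of ?u' k]] k[OF that]])
    then show ?thesis unfolding sub_conf_def by (simp only: rescale_inj[OF coprime_CHAR_units[OF cop]])
  qed
  have "w' (hmul h (hmul ?m (hmul (dil ?p ?q k) g0))) = w h" if h: "h \<in> F" for h
  proof -
    have "?v (hmul h ?m) = ?u (hmul h ?m)"
    proof (cases "special ?p ?q (hmul h ?m)")
      case True
      then obtain k' where "k' \<in> F'" "near ?p ?q (dil ?p ?q k') (hmul h ?m)" using near[OF h] by blast
      then show ?thesis using agree_near[OF v lv u l ag] by blast
    next
      case False
      then show ?thesis by (rule agree_not_special[OF v lv u l])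
    qed
    then show ?thesis by (simp only: hmul_assoc hmul_hinv hmul_hone)
  qed
  then show "\<exists>g. \<forall>h\<in>F. w' (hmul h g) = w h" by blast
qed

text \<open>A bound on \<open>z\<close> linear in \<open>N\<close> suffices, since the sublattice
  divides \<open>z\<close> by \<open>p q\<close>. The factor 4 fits both ends: two heights in
  \<open>hbox 1\<close> differ by at most 8, and the contraction estimate comes down to
  \<open>3 * N - 5 > 0\<close> for \<open>N \<ge> 2\<close>.\<close>

definition hbox :: "int \<Rightarrow> heis set" where
  "hbox N = {(x,y,z). \<bar>x\<bar> \<le> N \<and> \<bar>y\<bar> \<le> N \<and> \<bar>z\<bar> \<le> 4 * N}"

text \<open>This box need not shrink further, as the quotients -1 and 1 can reappear. Instead all
  its special elements turn out to be near one and the same sublattice element, and a single tile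
  suffices.\<close>

lemma common_patterns_box_1:
  assumes cop: "coprime CHAR('a::large_prime_field) CHAR('b::large_prime_field)"
  shows "common_patterns TYPE(('a,'b) tile) (hbox 1)"
proof (rule common_patterns_step[OF cop])
  let ?p = "int CHAR('a)" and ?q = "int CHAR('b)"
  have big: "11 \<le> ?p" "11 \<le> ?q" using CHAR_large[where ?'a='a] CHAR_large[where ?'a='b] by auto
  fix a b c :: int
  \<comment> \<open>Rounding \<open>u\<close> down to a multiple of \<open>n\<close> fails only for
    residue \<open>n - 1\<close>, at \<open>x = 1\<close>; there rounding up works.\<close>
  have ex_mult: "\<exists>v. n dvd v \<and> (\<forall>x. \<bar>x\<bar> \<le> 1 \<longrightarrow> \<bar>x + u - v\<bar> < n)" if "11 \<le> n" for n u :: int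
  proof (cases "u mod n = n - 1")
    case True
    then have "u = n * (u div n) + (n - 1)" using mult_div_mod_eq[of n u] by simp
    then have "u + 1 = n * (u div n + 1)" by (simp add: algebra_simps)
    then have "n dvd u + 1" by (metis dvd_triv_left)
    then show ?thesis using that by (intro exI[of _ "u + 1"]) auto
  next
    case False
    then have "0 \<le> u mod n" "u mod n < n - 1"
      using that pos_mod_bound[of n u] pos_mod_sign[of n u] by linarith+
    then show ?thesis using that
      by (intro exI[of _ "u - u mod n"] conjI allI impI) (simp add: dvd_minus_mod, linarith)
  qed
  obtain xc where xc: "?q dvd xc" "\<And>x. \<bar>x\<bar> \<le> 1 \<Longrightarrow> \<bar>x + a - xc\<bar> < ?q" using ex_mult[OF big(2)] by blast
  obtain yc where yc: "?p dvd yc" "\<And>y. \<bar>y\<bar> \<le> 1 \<Longrightarrow> \<bar>y + b - yc\<bar> < ?p" using ex_mult[OF big(1)] by blast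
  have small: "u = v" if "n dvd u" "n dvd v" "\<bar>u - v\<bar> < n" for n u v :: int
    using zdvd_not_zless[of "\<bar>u - v\<bar>" n] that by (cases "u = v") (auto simp: dvd_diff)
  \<comment> \<open>The height after sliding along the \<open>X\<close>-line to first coordinate
    \<open>xc\<close>, provided the second coordinate is \<open>yc\<close>. If
    \<open>x + a = xc\<close>, the correction is 0 and the element lies on the \<open>Y\<close>-line
    instead.\<close>
  define zc where "zc x z = z + c + x * b + (xc - (x + a)) * yc" for x z
  have sp: "?p dvd zc x z \<and> ?q dvd zc x z \<and> (y + b = yc \<or> x + a = xc)"
    if "(x,y,z) \<in> hbox 1" "special ?p ?q (hmul (x,y,z) (a,b,c))" for x y z
  proof -
    have bx: "\<bar>x\<bar> \<le> 1" "\<bar>y\<bar> \<le> 1" "\<bar>z\<bar> \<le> 4" using that by (auto simp: hbox_def)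
    have d: "?p dvd z + c + x * b" "?q dvd (x + a) * (y + b) - (z + c + x * b)" "?p dvd y + b \<or> ?q dvd x + a"
      using that(2) by (auto simp: special_def)
    have "?p dvd zc x z" unfolding zc_def using d(1) yc(1) by simp
    moreover have e: "y + b = yc \<or> x + a = xc"
      using d(3) small[OF _ xc(1), of "x+a"] small[OF _ yc(1), of "y+b"] xc(2)[OF bx(1)] yc(2)[OF bx(2)] by auto
    moreover have "?q dvd zc x z"
    proof -
      have "zc x z = xc * yc - ((x + a) * (y + b) - (z + c + x * b))"
        if "y + b = yc" unfolding zc_def that[symmetric] by (simp add: algebra_simps)
      moreover have "zc x z = xc * (y + b) - ((x + a) * (y + b) - (z + c + x * b))"
        if "x + a = xc" unfolding zc_def that[symmetric] by (simp add: algebra_simps)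
      ultimately show ?thesis using e d(2) xc(1) by (metis dvd_diff dvd_mult2)
    qed
    ultimately show ?thesis by blast
  qed
  have uniq: "zc x1 z1 = zc x2 z2"
    if "(x1,y1,z1) \<in> hbox 1" "special ?p ?q (hmul (x1,y1,z1) (a,b,c))"
       "(x2,y2,z2) \<in> hbox 1" "special ?p ?q (hmul (x2,y2,z2) (a,b,c))" for x1 y1 z1 x2 y2 z2
  proof (rule small[of ?p])
    have bx: "\<bar>x1\<bar> \<le> 1" "\<bar>y1\<bar> \<le> 1" "\<bar>z1\<bar> \<le> 4" "\<bar>x2\<bar> \<le> 1" "\<bar>y2\<bar> \<le> 1" "\<bar>z2\<bar> \<le> 4" using that by (auto simp: hbox_def)
    have 1: "y1 + b = yc \<or> x1 + a = xc" and 2: "y2 + b = yc \<or> x2 + a = xc" using sp that by blast+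
    have m: "\<bar>(x1 - x2) * y\<bar> \<le> 2" if "\<bar>y\<bar> \<le> 1" for y
    proof -
      have "\<bar>x1 - x2\<bar> * \<bar>y\<bar> \<le> 2 * 1" by (rule mult_mono) (use bx that in auto)
      then show ?thesis by (simp add: abs_mult)
    qed
    have "zc x1 z1 - zc x2 z2 = z1 - z2 - (x1 - x2) * (yc - b)" by (simp add: zc_def algebra_simps)
    \<comment> \<open>If \<open>yc - b\<close> is larger than 1 in absolute value, no element of the
      box has second coordinate \<open>yc\<close>, so both elements have first coordinate
      \<open>xc\<close>. Together with 8 from the heights the total is 10, below
      \<open>?p\<close>.\<close>
    moreover have "\<bar>(x1 - x2) * (yc - b)\<bar> \<le> 2"
    proof (cases "\<bar>yc - b\<bar> \<le> 1")
      case True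
      then show ?thesis by (rule m)
    next
      case False
      then have "x1 = x2" using 1 2 bx by auto
      then show ?thesis by simp
    qed
    ultimately show "\<bar>zc x1 z1 - zc x2 z2\<bar> < ?p" using bx big by linarith
  qed (use sp that in blast)+
  show "\<exists>F'. common_patterns TYPE(('a,'b) tile) F' \<and> (\<forall>h\<in>hbox 1. special ?p ?q (hmul h (a,b,c)) \<longrightarrow>
        (\<exists>k\<in>F'. near ?p ?q (dil ?p ?q k) (hmul h (a,b,c))))"
  proof (cases "\<exists>h\<in>hbox 1. special ?p ?q (hmul h (a,b,c))")
    case False
    then show ?thesis using common_patterns_single[OF cop] by blast
  next
    case True
    then obtain x1 y1 z1 where h1: "(x1,y1,z1) \<in> hbox 1" "special ?p ?q (hmul (x1,y1,z1) (a,b,c))"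
      by (metis surj_pair)
    let ?z = "zc x1 z1"
    have "?p * ?q dvd ?z" using sp[OF h1] cop by (intro divides_mult) auto
    then obtain x' y' z' where "xc = ?q * x'" "yc = ?p * y'" "?z = ?p * ?q * z'"
      using xc(1) yc(1) unfolding dvd_def by blast
    then have k: "dil ?p ?q (x',y',z') = (xc,yc,?z)" by simp
    show ?thesis
    proof (intro exI[of _ "{(x',y',z')}"] conjI ballI impI)
      show "common_patterns TYPE(('a,'b) tile) {(x',y',z')}" by (rule common_patterns_single[OF cop])
      fix h assume h: "h \<in> hbox 1" "special ?p ?q (hmul h (a,b,c))"
      obtain x y z where hx: "h = (x,y,z)" by (cases h) auto
      have bx: "\<bar>x\<bar> \<le> 1" "\<bar>y\<bar> \<le> 1" using h by (auto simp: hbox_def hx)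
      have zz: "?z = zc x z" using uniq[OF h1] h hx by blast
      consider "y + b = yc" | "x + a = xc" using sp h hx by blast
      then have "near ?p ?q (xc,yc,?z) (hmul h (a,b,c))"
      proof cases
        case 1
        have "hmul h (a,b,c) = (xc + (x + a - xc), yc, ?z + (x + a - xc) * yc)"
          unfolding zz unfolding zc_def using 1 by (simp add: hx algebra_simps)
        then show ?thesis using xc(2)[OF bx(1)] unfolding near_def by blast
      next
        case 2
        have "hmul h (a,b,c) = (xc, yc + (y + b - yc), ?z)"
          unfolding zz unfolding zc_def using 2 by (simp add: hx algebra_simps)
        then show ?thesis using yc(2)[OF bx(2)] unfolding near_def by blast
      qed
      then show "\<exists>k\<in>{(x',y',z')}. near ?p ?q (dil ?p ?q k) (hmul h (a,b,c))" using k by simp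
    qed
  qed
qed

lemma div_bound:
  fixes N q X :: int
  assumes "2 \<le> N" "2 \<le> q" "- N \<le> X" "X < N + q"
  shows "\<bar>X div q\<bar> \<le> N - 1"
proof -
  have a: "N \<le> q * (N - 1)" using mult_mono[of 2 q "N-1" "N-1"] assms by auto
  have "X div q < N"
  proof (rule ccontr)
    assume "\<not> X div q < N"
    then have "q * N \<le> q * (X div q)" using assms by (intro mult_left_mono) auto
    also have "\<dots> \<le> X" using mult_div_mod_eq[of q X] pos_mod_sign[of q X] assms by linarith
    finally show False using assms a by (simp add: algebra_simps)
  qed
  moreover have "- (N - 1) \<le> X div q"
  proof -
    have "(- (N - 1) * q) div q \<le> X div q"
      by (rule zdiv_mono1) (use assms a in \<open>auto simp: algebra_simps\<close>)
    then show ?thesis using assms by simp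
  qed
  ultimately show ?thesis by simp
qed

lemma common_patterns_box_step:
  assumes cop: "coprime CHAR('a::large_prime_field) CHAR('b::large_prime_field)"
    and N: "2 \<le> N" and IH: "common_patterns TYPE(('a,'b) tile) (hbox (N - 1))"
  shows "common_patterns TYPE(('a,'b) tile) (hbox N)"
proof (rule common_patterns_step[OF cop], intro exI[of _ "hbox (N-1)"] conjI ballI impI IH)
  let ?p = "int CHAR('a)" and ?q = "int CHAR('b)"
  have big: "11 \<le> ?p" "11 \<le> ?q" using CHAR_large[where ?'a='a] CHAR_large[where ?'a='b] by auto
  fix a b c and h :: heis
  assume abc: "0 \<le> a" "a < ?q" "0 \<le> b" "b < ?p" "0 \<le> c" "c < ?p * ?q"
    and h: "h \<in> hbox N" "special ?p ?q (hmul h (a,b,c))"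
  obtain x y z where hx: "h = (x,y,z)" by (cases h) auto
  have bx: "\<bar>x\<bar> \<le> N" "\<bar>y\<bar> \<le> N" "\<bar>z\<bar> \<le> 4*N" using h by (auto simp: hbox_def hx)
  define X Y Z where "X = x + a" and "Y = y + b" and "Z = z + c + x * b"
  have hm: "hmul h (a,b,c) = (X,Y,Z)" by (simp add: hx X_def Y_def Z_def)
  have d: "?p dvd Z" "?q dvd X*Y - Z" "?p dvd Y \<or> ?q dvd X" using h(2) by (auto simp: hm special_def)
  \<comment> \<open>Sliding back by \<open>i\<close> along the \<open>X\<close>-line leads to the
    sublattice if \<open>?p\<close> divides \<open>Y\<close>. Otherwise \<open>?q\<close> divides
    \<open>X\<close>, so \<open>i = 0\<close> and the sublattice element lies on the
    \<open>Y\<close>-line; one formula for \<open>K\<close> covers both.\<close>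
  define i where "i = X mod ?q"
  have i: "0 \<le> i" "i < ?q" using big by (auto simp: i_def)
  have iX: "X = ?q * (X div ?q) + i" by (simp add: i_def)
  have "?p dvd Z - i * Y" "?q dvd Z - i * Y"
  proof -
    show "?p dvd Z - i * Y"
      using d(3)
    proof
      assume "?p dvd Y"
      then show ?thesis using d(1) by (intro dvd_diff dvd_mult)
    next
      assume "?q dvd X"
      then have "i = 0" by (simp add: i_def)
      then show ?thesis using d(1) by simp
    qed
    have "Z - i * Y = ?q * (D * Y) - ((?q * D + i) * Y - Z)" for D by (simp add: algebra_simps)
    from this[of "X div ?q"] have "Z - i * Y = ?q * ((X div ?q) * Y) - (X * Y - Z)" unfolding iX[symmetric] .
    then show "?q dvd Z - i * Y" using d(2) by (metis dvd_diff dvd_triv_left)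
  qed
  then have "?p * ?q dvd Z - i * Y" using cop by (intro divides_mult) auto
  then obtain K where K: "Z - i * Y = ?p * ?q * K" by (auto elim: dvdE)
  let ?k = "(X div ?q, Y div ?p, K)"
  have "\<bar>K\<bar> \<le> 4 * (N - 1)"
  proof (rule ccontr)
    assume "\<not> ?thesis"
    then have "4 * N - 3 \<le> \<bar>K\<bar>" by simp
    then have "?p * ?q * (4 * N - 3) \<le> \<bar>Z - i * Y\<bar>" unfolding K abs_mult by (simp add: mult_left_mono)
    moreover have "\<bar>Z\<bar> \<le> 4 * N + ?p * ?q + N * ?p"
    proof -
      have "\<bar>x\<bar> * \<bar>b\<bar> \<le> N * ?p" by (rule mult_mono) (use bx abc in auto)
      then have "\<bar>x * b\<bar> \<le> N * ?p" by (simp add: abs_mult)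
      then show ?thesis unfolding Z_def using bx abc by linarith
    qed
    moreover have "\<bar>i * Y\<bar> \<le> N * ?q + ?p * ?q"
    proof -
      have "\<bar>i\<bar> * \<bar>Y\<bar> \<le> ?q * (N + ?p)" by (rule mult_mono) (use i bx abc in \<open>auto simp: Y_def\<close>)
      then show ?thesis by (simp add: abs_mult algebra_simps)
    qed
    moreover have "N * (4 + ?p + ?q) \<le> N * (?p * ?q)"
    proof (rule mult_left_mono)
      have "(?p - 1) * (?q - 1) \<ge> 10 * 10" by (rule mult_mono) (use big in auto)
      then show "4 + ?p + ?q \<le> ?p * ?q" by (simp add: algebra_simps)
    qed (use N in simp)
    moreover have "0 < (?p * ?q) * (3 * N - 5)" using big N by simp
    moreover have "?p * ?q * (4 * N - 3) = 4 * (N * (?p * ?q)) - 3 * (?p * ?q)"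
      "(?p * ?q) * (3 * N - 5) = 3 * (N * (?p * ?q)) - 5 * (?p * ?q)"
      "N * (4 + ?p + ?q) = 4 * N + N * ?p + N * ?q"
      by (simp_all add: algebra_simps)
    ultimately show False by linarith
  qed
  moreover have "\<bar>X div ?q\<bar> \<le> N - 1" by (rule div_bound) (use N big bx abc in \<open>auto simp: X_def\<close>)
  moreover have "\<bar>Y div ?p\<bar> \<le> N - 1" by (rule div_bound) (use N big bx abc in \<open>auto simp: Y_def\<close>)
  ultimately have kb: "?k \<in> hbox (N - 1)" by (simp add: hbox_def)
  have "near ?p ?q (dil ?p ?q ?k) (X,Y,Z)"
  proof (cases "?p dvd Y")
    case True
    then have "(X,Y,Z) = (?q * (X div ?q) + i, ?p * (Y div ?p), ?p * ?q * K + i * (?p * (Y div ?p)))"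
      using iX K by (simp add: algebra_simps)
    then show ?thesis unfolding near_def dil_simp using i by auto
  next
    case False
    then have "i = 0" using d(3) by (simp add: i_def)
    then have "(X,Y,Z) = (?q * (X div ?q), ?p * (Y div ?p) + Y mod ?p, ?p * ?q * K)"
      using iX K by simp
    moreover have "\<bar>Y mod ?p\<bar> < ?p" using big by simp
    ultimately show ?thesis unfolding near_def dil_simp by blast
  qed
  then show "\<exists>k\<in>hbox (N-1). near ?p ?q (dil ?p ?q k) (hmul h (a,b,c))"
    unfolding hm using kb by blast
qed

lemma common_patterns_box:
  assumes cop: "coprime CHAR('a::large_prime_field) CHAR('b::large_prime_field)"
  shows "common_patterns TYPE(('a,'b) tile) (hbox (int n + 1))"
proof (induction n)
  case 0
  then show ?case using common_patterns_box_1[OF cop] by simp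
next
  case (Suc n)
  then show ?case using common_patterns_box_step[OF cop, of "int (Suc n) + 1"] by (simp add: add.commute)
qed


section \<open>Existence\<close>

definition lev :: "int \<Rightarrow> int \<Rightarrow> int \<Rightarrow> nat" where
  "lev p a b = multiplicity p (gcd a b)"

lemma le_lev_iff:
  assumes "1 < p" "a \<noteq> 0 \<or> b \<noteq> 0"
  shows "k \<le> lev p a b \<longleftrightarrow> p ^ k dvd a \<and> p ^ k dvd b"
  unfolding lev_def using assms
  by (subst power_dvd_iff_le_multiplicity[symmetric]) (auto simp: zdvd1_eq)

text \<open>Division rounded up: a signal announces the next comparable element at or after the
  current one.\<close>

definition cdiv :: "int \<Rightarrow> int \<Rightarrow> int" where
  "cdiv a b = - ((- a) div b)"

lemma cdiv_dvd: "b dvd a \<Longrightarrow> cdiv a b = a div b"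
  by (auto simp: cdiv_def dvd_neg_div)

lemma cdiv_add_1:
  assumes "0 < b"
  shows "cdiv (a + 1) b = (if b dvd a then cdiv a b + 1 else cdiv a b)"
proof -
  define r where "r = (-a) mod b"
  define d where "d = (-a) div b"
  have e: "- a = b * d + r" "0 \<le> r" "r < b" using assms by (simp_all add: r_def d_def)
  have z: "b dvd a \<longleftrightarrow> r = 0" unfolding r_def by (simp add: dvd_eq_mod_eq_0[symmetric])
  show ?thesis
  proof (cases "r = 0")
    case True
    have "(- (a + 1)) div b = d - 1"
      by (rule int_div_pos_eq[where r="b-1"]) (use e True assms in \<open>auto simp: algebra_simps\<close>)
    then show ?thesis using z True by (simp add: cdiv_def d_def)
  next
    case False
    have "(- (a + 1)) div b = d"
      by (rule int_div_pos_eq[where r="r-1"]) (use e False assms in auto)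
    then show ?thesis using z False by (simp add: cdiv_def d_def)
  qed
qed

definition digits :: "int \<Rightarrow> int \<Rightarrow> int \<Rightarrow> 'a::ring_1 \<times> 'a" where
  "digits d a b = (of_int (a div d), of_int (b div d))"

definition cdigits :: "int \<Rightarrow> int \<Rightarrow> int \<Rightarrow> 'a::ring_1 \<times> 'a" where
  "cdigits d a b = (of_int (cdiv a d), of_int (b div d))"

lemma digits_nonzero:
  fixes a b :: int
  assumes "a \<noteq> 0 \<or> b \<noteq> 0" "1 < int CHAR('a::ring_1)"
  shows "digits (int CHAR('a) ^ lev (int CHAR('a)) a b) a b \<noteq> (0 :: 'a \<times> 'a)"
proof
  let ?p = "int CHAR('a)"
  let ?n = "lev ?p a b"
  assume 0: "digits (?p ^ ?n) a b = (0 :: 'a \<times> 'a)"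
  have d: "?p ^ ?n dvd a" "?p ^ ?n dvd b" using le_lev_iff[OF assms(2,1), of ?n] by auto
  have "?p dvd a div ?p ^ ?n" "?p dvd b div ?p ^ ?n"
    using 0 by (simp_all add: digits_def zero_prod_def of_int_eq_0_iff_char_dvd)
  then have "?p ^ Suc ?n dvd a \<and> ?p ^ Suc ?n dvd b"
    using mult_dvd_mono[OF dvd_refl[of "?p ^ ?n"]] d unfolding power_Suc2 by (metis dvd_mult_div_cancel)
  then show False using le_lev_iff[OF assms(2,1), of "Suc ?n"] by simp
qed

lemma of_int_div_power_zero:
  assumes "int CHAR('a::ring_1) ^ Suc m dvd a" "0 < CHAR('a)"
  shows "(of_int (a div int CHAR('a) ^ m) :: 'a) = 0"
  using assms unfolding of_int_eq_0_iff_char_dvd by (auto simp: dvd_def)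

lemma cdigits_zero:
  assumes "int CHAR('a::ring_1) ^ Suc m dvd a" "int CHAR('a) ^ Suc m dvd b" "0 < CHAR('a)"
  shows "cdigits (int CHAR('a) ^ m) a b = (0 :: 'a \<times> 'a)"
proof -
  have "int CHAR('a) ^ m dvd a" using assms(1) by (metis dvd_mult_right power_Suc)
  then show ?thesis
    using of_int_div_power_zero[OF assms(1,3)] of_int_div_power_zero[OF assms(2,3)]
    by (simp add: cdigits_def cdiv_dvd zero_prod_def)
qed

lemma cdigits_eq_digits: "d dvd a \<Longrightarrow> cdigits d a b = digits d a b"
  by (simp add: cdigits_def digits_def cdiv_dvd)

lemma digits_shear: "d dvd a \<Longrightarrow> digits d a (b + a) = sh (digits d a b)"
  by (simp add: digits_def sh_def div_plus_div_distrib_dvd_right)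

lemma cdigits_step:
  "0 < d \<Longrightarrow> cdigits d (a + 1) b = (if d dvd a then inc (cdigits d a b) else cdigits d a b)"
  by (simp add: cdigits_def inc_def cdiv_add_1)

lemma lev_shear: "lev p a (b + a) = lev p a b"
  by (simp add: lev_def add.commute[of b])

text \<open>
  The configuration whose hierarchy is centred at the point \<open>y = z = 0\<close> and the line \<open>x = z = 0\<close>.
  These two have infinite level, so their labels are free choices; \<open>lev\<close> is meaningless there.
\<close>

context
  fixes p q :: int
begin

definition hier_st :: "int \<Rightarrow> int \<Rightarrow> int \<Rightarrow> status" where
  "hier_st x y z = (if y = 0 \<and> z = 0 then PointDeep else if x = 0 \<and> x*y-z = 0 then LineDeep
     else if lev q x (x*y-z) < lev p y z then PointDeep
     else if lev p y z < lev q x (x*y-z) then LineDeep else Same)"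

definition hier_ptl :: "int \<Rightarrow> int \<Rightarrow> int \<Rightarrow> 'a::ring_1 \<times> 'a" where
  "hier_ptl x y z = (if \<not> (y = 0 \<and> z = 0) \<and> q ^ lev p y z dvd x*y-z then digits (p ^ lev p y z) y z else 0)"

definition hier_pen :: "int \<Rightarrow> int \<Rightarrow> int \<Rightarrow> 'b::ring_1 \<times> 'b" where
  "hier_pen x y z = (if \<not> (y = 0 \<and> z = 0) \<and> q ^ lev p y z dvd x*y-z then cdigits (q ^ lev p y z) x (x*y-z) else 0)"

text \<open>At the identity the central point counts as deeper than the central line, so the line
  needs a nonzero label; \<open>(0,1)\<close> is fixed by \<open>sh\<close>. The central point can
  stay blank.\<close>

definition hier_lnl :: "int \<Rightarrow> int \<Rightarrow> int \<Rightarrow> 'b::ring_1 \<times> 'b" where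
  "hier_lnl x y z = (if x = 0 \<and> x*y-z = 0 then (0,1)
     else if p ^ lev q x (x*y-z) dvd z then digits (q ^ lev q x (x*y-z)) x (x*y-z) else 0)"

text \<open>On the central line every status is \<open>LineDeep\<close> except at
  \<open>y = 0\<close>, so the signal increases once, just after that element.\<close>

definition hier_row :: "int \<Rightarrow> int \<Rightarrow> int \<Rightarrow> 'a::ring_1 \<times> 'a" where
  "hier_row x y z = (if x = 0 \<and> x*y-z = 0 then (if y \<le> 0 then 0 else (1,0))
     else if p ^ lev q x (x*y-z) dvd z then cdigits (p ^ lev q x (x*y-z)) y z else 0)"

definition hier :: "heis \<Rightarrow> ('a::ring_1, 'b::ring_1) tile" where
  "hier g = (case g of (x,y,z) \<Rightarrow>
     Tile (hier_st x y z) (hier_ptl x y z) (hier_lnl x y z) (hier_row x y z) (hier_pen x y z))"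

end

lemma valid_hier:
  assumes P: "1 < CHAR('a::field)" and Q: "1 < CHAR('b::field)"
  shows "valid (hier (int CHAR('a)) (int CHAR('b)) :: heis \<Rightarrow> ('a, 'b) tile)"
  unfolding valid_def
proof (intro allI conjI)
  let ?p = "int CHAR('a)" and ?q = "int CHAR('b)"
  let ?w = "hier ?p ?q :: heis \<Rightarrow> ('a, 'b) tile"
  have pq: "1 < ?p" "1 < ?q" using P Q by auto
  then have pos: "0 < ?p ^ k" "0 < ?q ^ k" for k by auto
  fix g :: heis
  obtain x y z where g: "g = (x,y,z)" by (cases g) auto
  define v where "v = x*y-z"
  define n where "n = lev ?p y z"
  define m where "m = lev ?q x v"
  note defs = hier_def hier_st_def hier_ptl_def hier_lnl_def hier_row_def hier_pen_def
  have n: "k \<le> n \<longleftrightarrow> ?p ^ k dvd y \<and> ?p ^ k dvd z" if "\<not> (y = 0 \<and> z = 0)" for k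
    unfolding n_def using le_lev_iff[OF pq(1)] that by blast
  have m: "k \<le> m \<longleftrightarrow> ?q ^ k dvd x \<and> ?q ^ k dvd v" if "\<not> (x = 0 \<and> v = 0)" for k
    unfolding m_def using le_lev_iff[OF pq(2)] that by blast
  have nz: "digits (?p ^ n) y z \<noteq> (0 :: 'a \<times> 'a)" if "\<not> (y = 0 \<and> z = 0)"
    unfolding n_def by (rule digits_nonzero) (use that pq in auto)
  have mz: "digits (?q ^ m) x v \<noteq> (0 :: 'b \<times> 'b)" if "\<not> (x = 0 \<and> v = 0)"
    unfolding m_def by (rule digits_nonzero) (use that pq in auto)
  have wg: "?w g = Tile (if y = 0 \<and> z = 0 then PointDeep else if x = 0 \<and> v = 0 then LineDeep
       else if m < n then PointDeep else if n < m then LineDeep else Same)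
     (if \<not> (y = 0 \<and> z = 0) \<and> ?q ^ n dvd v then digits (?p ^ n) y z else 0)
     (if x = 0 \<and> v = 0 then (0,1) else if ?p ^ m dvd z then digits (?q ^ m) x v else 0)
     (if x = 0 \<and> v = 0 then (if y \<le> 0 then 0 else (1,0)) else if ?p ^ m dvd z then cdigits (?p ^ m) y z else 0)
     (if \<not> (y = 0 \<and> z = 0) \<and> ?q ^ n dvd v then cdigits (?q ^ n) x v else 0)"
    unfolding g defs prod.case v_def[symmetric] n_def[symmetric] m_def[symmetric] ..
  show "ok_tile (?w g)"
  proof (cases "y = 0 \<and> z = 0")
    case c: True
    then have v0: "v = 0" by (simp add: v_def)
    show ?thesis
      unfolding wg using c v0 mz by (auto simp: ok_tile_def cdigits_def cdiv_def zero_prod_def)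
  next
    case c: False
    show ?thesis
    proof (cases "x = 0 \<and> v = 0")
      case l: True
      then have z0: "z = 0" by (auto simp: v_def)
      show ?thesis
        unfolding wg using c l z0 nz by (auto simp: ok_tile_def cdigits_def cdiv_def zero_prod_def digits_def)
    next
      case l: False
      have dn: "?p ^ n dvd y" "?p ^ n dvd z" using n[OF c, of n] by auto
      have dm: "?q ^ m dvd x" "?q ^ m dvd v" using m[OF l, of m] by auto
      consider "m < n" | "n < m" | "n = m" by linarith
      then show ?thesis
      proof cases
        case 1
        have pz: "?p ^ Suc m dvd y" "?p ^ Suc m dvd z" using n[OF c, of "Suc m"] 1 by auto
        then have "?p ^ m dvd z" by (metis dvd_mult_right power_Suc)
        moreover have "cdigits (?p ^ m) y z = (0 :: 'a \<times> 'a)" by (rule cdigits_zero[OF pz]) (use P in simp)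
        moreover have "snd (digits (?q ^ m) x v :: 'b \<times> 'b) = 0" if "?q ^ n dvd v"
        proof -
          have "?q ^ Suc m dvd v" using that 1 by (meson Suc_leI dvd_trans le_imp_power_dvd)
          then show ?thesis using of_int_div_power_zero[of m v, where ?'a='b] Q by (simp add: digits_def)
        qed
        ultimately show ?thesis unfolding wg using c l 1 mz[OF l] nz[OF c] by (auto simp: ok_tile_def)
      next
        case 2
        have pz: "?q ^ Suc n dvd x" "?q ^ Suc n dvd v" using m[OF l, of "Suc n"] 2 by auto
        then have "?q ^ n dvd v" by (metis dvd_mult_right power_Suc)
        moreover have "cdigits (?q ^ n) x v = (0 :: 'b \<times> 'b)" by (rule cdigits_zero[OF pz]) (use Q in simp)
        moreover have "snd (digits (?p ^ n) y z :: 'a \<times> 'a) = 0" if "?p ^ m dvd z"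
        proof -
          have "?p ^ Suc n dvd z" using that 2 by (meson Suc_leI dvd_trans le_imp_power_dvd)
          then show ?thesis using of_int_div_power_zero[of n z, where ?'a='a] P by (simp add: digits_def)
        qed
        ultimately show ?thesis unfolding wg using c l 2 mz[OF l] nz[OF c] by (auto simp: ok_tile_def)
      next
        case 3
        then show ?thesis unfolding wg using c l mz[OF l] nz[OF c] dn dm by (auto simp: ok_tile_def cdigits_eq_digits)
      qed
    qed
  qed
  show "ok_X (?w g) (?w (hmul (1,0,0) g))"
  proof -
    have X: "hmul (1,0,0) g = (x+1,y,z+y)" by (simp add: g)
    have v': "(x+1)*y-(z+y) = v" by (simp add: v_def algebra_simps)
    have n': "lev ?p y (z+y) = n" by (simp add: n_def lev_shear)
    have c': "y = 0 \<and> z + y = 0 \<longleftrightarrow> y = 0 \<and> z = 0" by auto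
    have ptl': "ptl (?w (hmul (1,0,0) g)) = (if \<not> (y = 0 \<and> z = 0) \<and> ?q ^ n dvd v then digits (?p ^ n) y (z+y) else 0)"
      and pen': "pen (?w (hmul (1,0,0) g)) = (if \<not> (y = 0 \<and> z = 0) \<and> ?q ^ n dvd v then cdigits (?q ^ n) (x+1) v else 0)"
      unfolding X hier_def prod.case tile.sel hier_ptl_def hier_pen_def v' n' c' by rule+
    show ?thesis
    proof (cases "\<not> (y = 0 \<and> z = 0) \<and> ?q ^ n dvd v")
      case True
      have dn: "?p ^ n dvd y" using n[of n] True by auto
      \<comment> \<open>As \<open>?q ^ n\<close> divides \<open>v\<close>, the line reaches level
        \<open>n\<close> exactly when \<open>?q ^ n\<close> divides \<open>x\<close>, which is also
        where the rounded-up quotient advances.\<close>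
      have "st (?w g) = PointDeep \<longleftrightarrow> \<not> ?q ^ n dvd x"
        unfolding wg using True m[of n] by auto
      moreover have "ptl (?w g) = digits (?p ^ n) y z" "pen (?w g) = cdigits (?q ^ n) x v"
        unfolding wg using True by auto
      ultimately show ?thesis unfolding ok_X_def ptl' pen' using True dn pos
        by (auto simp: digits_shear cdigits_step)
    next
      case False
      have "st (?w g) = PointDeep" unfolding wg using False m[of n] by auto
      moreover have "ptl (?w g) = 0" "pen (?w g) = 0" unfolding wg tile.sel using False by (simp_all only: if_False)
      ultimately show ?thesis unfolding ok_X_def ptl' pen' using False by auto
    qed
  qed
  show "ok_Y (?w g) (?w (hmul (0,1,0) g))"
  proof -
    have Y: "hmul (0,1,0) g = (x,y+1,z)" by (simp add: g)
    have v': "x*(y+1)-z = v + x" by (simp add: v_def algebra_simps)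
    have m': "lev ?q x (v+x) = m" by (simp add: m_def lev_shear)
    have c': "x = 0 \<and> v + x = 0 \<longleftrightarrow> x = 0 \<and> v = 0" by auto
    have lnl': "lnl (?w (hmul (0,1,0) g)) = (if x = 0 \<and> v = 0 then (0,1) else if ?p ^ m dvd z then digits (?q ^ m) x (v+x) else 0)"
      and row': "row (?w (hmul (0,1,0) g)) = (if x = 0 \<and> v = 0 then (if y + 1 \<le> 0 then 0 else (1,0))
         else if ?p ^ m dvd z then cdigits (?p ^ m) (y+1) z else 0)"
      unfolding Y hier_def prod.case tile.sel hier_lnl_def hier_row_def v' m' c' by rule+
    show ?thesis
    proof (cases "x = 0 \<and> v = 0")
      case True
      then have "z = 0" by (auto simp: v_def)
      then show ?thesis unfolding ok_Y_def lnl' row' wg using True by (auto simp: sh_def inc_def)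
    next
      case l: False
      show ?thesis
      proof (cases "?p ^ m dvd z")
        case True
        have dm: "?q ^ m dvd x" using m[OF l, of m] by auto
        have "st (?w g) = LineDeep \<longleftrightarrow> \<not> ?p ^ m dvd y"
          unfolding wg using True l n[of m] by auto
        moreover have "lnl (?w g) = digits (?q ^ m) x v" "row (?w g) = cdigits (?p ^ m) y z"
          unfolding wg using True l by auto
        ultimately show ?thesis unfolding ok_Y_def lnl' row' using True l dm pos
          by (auto simp: digits_shear cdigits_step)
      next
        case False
        have c: "\<not> (y = 0 \<and> z = 0)" using False by auto
        have "st (?w g) = LineDeep" unfolding wg using False l c n[OF c, of m] by auto
        moreover have "lnl (?w g) = 0" "row (?w g) = 0" unfolding wg tile.sel using False l by (simp_all only: if_False)
        ultimately show ?thesis unfolding ok_Y_def lnl' row' using False l by auto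
      qed
    qed
  qed
qed


section \<open>The shift of finite type\<close>

lemma closed_SFT:
  assumes "is_SFT A X"
  shows "closed X"
proof -
  obtain \<F> where F: "finite \<F>" "\<forall>P\<in>\<F>. finite (fst P)"
    "X = {\<omega> \<in> full_shift A. \<forall>P\<in>\<F>. \<not> occurs P \<omega>}"
    using assms by (auto simp: is_SFT_def)
  have cyl: "closed {\<omega> :: config. \<omega> g \<in> S}" for g S
  proof -
    have "closed ((\<lambda>\<omega> :: config. \<omega> g) -` S)"
      by (rule closed_vimage) (auto simp: closed_def intro: open_discrete)
    then show ?thesis by (simp add: vimage_def)
  qed
  have "X = (\<Inter>g. {\<omega>. \<omega> g \<in> A}) \<inter> (\<Inter>P\<in>\<F>. \<Inter>g. \<Union>h\<in>fst P. {\<omega>. \<omega> (hmul h g) \<in> - {snd P h}})"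
    unfolding F(3) full_shift_def occurs_def by blast
  moreover have "closed (\<Inter>g. {\<omega> :: config. \<omega> g \<in> A})"
    by (intro closed_INT ballI cyl)
  moreover have "closed (\<Inter>P\<in>\<F>. \<Inter>g. \<Union>h\<in>fst P. {\<omega> :: config. \<omega> (hmul h g) \<in> - {snd P h}})"
    by (intro closed_INT closed_UN ballI cyl) (use F(2) in auto)
  ultimately show ?thesis by (simp only: closed_Int)
qed

lemma config_LIMSEQ:
  fixes f :: "nat \<Rightarrow> config"
  assumes "\<And>g. \<forall>\<^sub>F n in sequentially. f n g = \<omega> g"
  shows "f \<longlonglongrightarrow> \<omega>"
proof -
  have "limitin (product_topology (\<lambda>i. euclidean) UNIV) f \<omega> sequentially"
    unfolding limitin_componentwise using assms by (auto intro: tendsto_eventually)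
  then show ?thesis by (simp add: euclidean_product_topology)
qed

lemma finite_tile_UNIV: "finite (UNIV :: ('a::finite, 'b::finite) tile set)"
proof -
  have S: "(UNIV :: status set) = {Same, PointDeep, LineDeep}"
    using status.exhaust by auto
  have "(UNIV :: ('a, 'b) tile set) = (\<lambda>(s,f,l,r,p). Tile s f l r p) ` ({Same, PointDeep, LineDeep} \<times> UNIV)"
    unfolding S[symmetric] UNIV_Times_UNIV
    by (metis (no_types, lifting) case_prod_conv rangeI surj_def tile.exhaust UNIV_I)
  then show ?thesis by (metis finite_imageI finite_cartesian_product finite.emptyI finite.insertI finite)
qed

text \<open>The tile condition is absorbed into the alphabet; each adjacency rule becomes finitely
  many forbidden patterns on the identity and one generator. Occurrences are right translates, in
  accordance with the left neighbours in \<open>valid\<close>.\<close>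

lemma SFT_of_valid:
  fixes enc :: "('a::large_prime_field, 'b::large_prime_field) tile \<Rightarrow> nat"
  assumes inj: "inj enc"
  shows "is_SFT (enc ` Collect ok_tile) {enc \<circ> w | w. valid w}"
proof -
  let ?A = "enc ` Collect ok_tile"
  let ?pat = "\<lambda>u (S,T). ({hone, u}, \<lambda>h. if h = hone then enc S else enc T)"
  let ?\<F> = "?pat (1,0,0) ` {(S,T). \<not> ok_X S T} \<union> ?pat (0,1,0) ` {(S,T). \<not> ok_Y S T}"
  have fin: "finite S" for S :: "(('a,'b) tile \<times> ('a,'b) tile) set"
    by (rule finite_subset[OF _ finite_cartesian_product[OF finite_tile_UNIV finite_tile_UNIV]]) auto
  have occ: "occurs (?pat u (S,T)) (enc \<circ> w) \<longleftrightarrow> (\<exists>g. w g = S \<and> w (hmul u g) = T)" if "u \<noteq> hone" for u S T w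
    using that by (auto simp: occurs_def inj_eq[OF inj])
  have ne: "(1,0,0) \<noteq> hone" "(0,1,0) \<noteq> hone" by (auto simp: hone_def)
  have "{enc \<circ> w | w. valid w} = {\<omega> \<in> full_shift ?A. \<forall>P\<in>?\<F>. \<not> occurs P \<omega>}"
  proof (intro equalityI subsetI)
    fix \<omega> assume "\<omega> \<in> {enc \<circ> w | w. valid w}"
    then obtain w where w: "\<omega> = enc \<circ> w" "valid w" by auto
    have "\<omega> \<in> full_shift ?A" using valid_tile[OF w(2)] by (auto simp: full_shift_def w(1))
    moreover have "\<not> occurs P \<omega>" if "P \<in> ?\<F>" for P
      using that
    proof
      assume "P \<in> ?pat (1,0,0) ` {(S,T). \<not> ok_X S T}"
      then obtain S T where P: "P = ?pat (1,0,0) (S,T)" "\<not> ok_X S T" by auto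
      show ?thesis unfolding P(1) w(1) occ[OF ne(1)] using P(2) w(2) unfolding valid_def by blast
    next
      assume "P \<in> ?pat (0,1,0) ` {(S,T). \<not> ok_Y S T}"
      then obtain S T where P: "P = ?pat (0,1,0) (S,T)" "\<not> ok_Y S T" by auto
      show ?thesis unfolding P(1) w(1) occ[OF ne(2)] using P(2) w(2) unfolding valid_def by blast
    qed
    ultimately show "\<omega> \<in> {\<omega> \<in> full_shift ?A. \<forall>P\<in>?\<F>. \<not> occurs P \<omega>}" by blast
  next
    fix \<omega> assume a: "\<omega> \<in> {\<omega> \<in> full_shift ?A. \<forall>P\<in>?\<F>. \<not> occurs P \<omega>}"
    define w where "w = inv_into UNIV enc \<circ> \<omega>"
    have ok: "ok_tile (w g) \<and> enc (w g) = \<omega> g" for g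
    proof -
      have "\<omega> g \<in> ?A" using a unfolding full_shift_def by blast
      then show ?thesis using inj by (auto simp: w_def)
    qed
    have \<omega>: "\<omega> = enc \<circ> w" using ok by (auto simp: fun_eq_iff)
    have X: "ok_X (w g) (w (hmul (1,0,0) g))" for g
    proof (rule ccontr)
      assume n: "\<not> ok_X (w g) (w (hmul (1,0,0) g))"
      have "occurs (?pat (1,0,0) (w g, w (hmul (1,0,0) g))) (enc \<circ> w)" unfolding occ[OF ne(1)] by blast
      then show False using a n unfolding \<omega> by blast
    qed
    have Y: "ok_Y (w g) (w (hmul (0,1,0) g))" for g
    proof (rule ccontr)
      assume n: "\<not> ok_Y (w g) (w (hmul (0,1,0) g))"
      have "occurs (?pat (0,1,0) (w g, w (hmul (0,1,0) g))) (enc \<circ> w)" unfolding occ[OF ne(2)] by blast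
      then show False using a n unfolding \<omega> by blast
    qed
    have "valid w" unfolding valid_def using ok X Y by blast
    then show "\<omega> \<in> {enc \<circ> w | w. valid w}" using \<omega> by blast
  qed
  moreover have "finite ?A" by (rule finite_imageI) (rule finite_subset[OF subset_UNIV finite_tile_UNIV])
  moreover have "finite ?\<F>" using fin by blast
  moreover have "\<forall>P\<in>?\<F>. finite (fst P)" by auto
  ultimately show ?thesis unfolding is_SFT_def by blast
qed

lemma minimal_aperiodic_SFT:
  assumes cop: "coprime CHAR('a::large_prime_field) CHAR('b::large_prime_field)"
  shows "\<exists>A \<Omega>. is_SFT A \<Omega> \<and> minimal_subshift A \<Omega> \<and> strongly_aperiodic \<Omega>"
proof -
  obtain enc :: "('a,'b) tile \<Rightarrow> nat" where inj: "inj enc"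
    using finite_imp_inj_to_nat_seg[OF finite_tile_UNIV] by blast
  define A where "A = enc ` Collect ok_tile"
  define \<Omega> where "\<Omega> = {enc \<circ> w | w. valid w}"
  have sft: "is_SFT A \<Omega>" unfolding A_def \<Omega>_def by (rule SFT_of_valid[OF inj])
  have sh: "shift g (enc \<circ> w) = enc \<circ> (\<lambda>h. w (hmul h g))" for g w
    by (auto simp: shift_def)
  have inv: "shift_invariant \<Omega>"
    unfolding shift_invariant_def \<Omega>_def using sh valid_shift by blast
  have big: "11 \<le> CHAR('a)" "11 \<le> CHAR('b)" by (rule CHAR_large)+
  have "valid (hier (int CHAR('a)) (int CHAR('b)) :: heis \<Rightarrow> ('a,'b) tile)"
    by (rule valid_hier) (use big in auto)
  then have "\<Omega> \<noteq> {}" unfolding \<Omega>_def by blast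
  then have sub: "subshift A \<Omega>"
    using sft inv closed_SFT[OF sft] by (auto simp: subshift_def is_SFT_def)
  have ap: "strongly_aperiodic \<Omega>"
    unfolding strongly_aperiodic_def
  proof
    fix \<omega> assume "\<omega> \<in> \<Omega>"
    then obtain w where w: "\<omega> = enc \<circ> w" "valid w" unfolding \<Omega>_def by blast
    have "g = hone" if "shift g \<omega> = \<omega>" for g
    proof (rule valid_no_period[OF w(2) cop])
      fix h
      have "enc (w (hmul h g)) = enc (w h)" using fun_cong[OF that, of h] by (simp add: w(1) shift_def)
      then show "w (hmul h g) = w h" using inj by (simp add: inj_eq)
    qed
    moreover have "shift hone \<omega> = \<omega>" by (simp add: shift_def)
    ultimately show "stab \<omega> = {hone}" unfolding stab_def by blast
  qed
  have "Y = \<Omega>" if Y: "Y \<subseteq> \<Omega>" "Y \<noteq> {}" "closed Y" "shift_invariant Y" for Y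
  proof (rule subset_antisym[OF Y(1)], rule subsetI)
    fix \<omega> assume "\<omega> \<in> \<Omega>"
    then obtain w where w: "\<omega> = enc \<circ> w" "valid w" unfolding \<Omega>_def by blast
    obtain w' where w': "enc \<circ> w' \<in> Y" "valid w'" using Y(1,2) unfolding \<Omega>_def by blast
    have "\<exists>g. \<forall>h\<in>hbox (int n + 1). w' (hmul h g) = w h" for n
      using common_patterns_box[OF cop, of n] w(2) w'(2) unfolding common_patterns_def by blast
    then obtain g where g: "\<And>n h. h \<in> hbox (int n + 1) \<Longrightarrow> w' (hmul h (g n)) = w h" by metis
    \<comment> \<open>Translates of \<open>w'\<close> that agree with \<open>w\<close> on growing
      boxes converge to it, and \<open>Y\<close> is closed.\<close>
    show "\<omega> \<in> Y"
    proof (rule closed_sequentially[OF Y(3)])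
      show "shift (g n) (enc \<circ> w') \<in> Y" for n using Y(4) w'(1) unfolding shift_invariant_def by blast
      show "(\<lambda>n. shift (g n) (enc \<circ> w')) \<longlonglongrightarrow> \<omega>"
      proof (rule config_LIMSEQ)
        fix h :: heis
        obtain x y z where h: "h = (x,y,z)" by (cases h) auto
        have "h \<in> hbox (int n + 1)" if "n \<ge> nat (\<bar>x\<bar> + \<bar>y\<bar> + \<bar>z\<bar>)" for n
          using that unfolding h hbox_def nat_le_iff by (simp, intro conjI; linarith)
        then show "\<forall>\<^sub>F n in sequentially. shift (g n) (enc \<circ> w') h = \<omega> h"
          unfolding eventually_sequentially by (metis comp_apply g shift_def w(1))
      qed
    qed
  qed
  then have "minimal_subshift A \<Omega>" using sub unfolding minimal_subshift_def by blast
  then show ?thesis using sft ap by blast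
qed

section \<open>The fields with 11 and 13 elements\<close>

class large_prime_card = prime_card +
  assumes CARD_large: "11 \<le> CARD('a)"

instance mod_ring :: (large_prime_card) large_prime_field
proof
  fix x :: "'a mod_ring"
  show "\<exists>k. x = of_int k"
    by (metis of_int_of_int_mod_ring of_int_mod_ring_to_int_mod_ring)
  show "11 \<le> CHAR('a mod_ring)"
    using CARD_large by simp
qed

text \<open>11 and 13 are the two smallest primes that meet the bound; being distinct, they are
  coprime.\<close>

typedef eleven = "{..<11::nat}" by (rule exI[of _ 0]) simp
typedef thirteen = "{..<13::nat}" by (rule exI[of _ 0]) simp

lemma CARD_eleven: "CARD(eleven) = 11"
  using type_definition.card[OF type_definition_eleven] by simp

lemma CARD_thirteen: "CARD(thirteen) = 13"
  using type_definition.card[OF type_definition_thirteen] by simp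

instance eleven :: large_prime_card
  by standard (simp_all add: CARD_eleven)

instance thirteen :: large_prime_card
  by standard (simp_all add: CARD_thirteen)

theorem theorem1:
  shows "\<exists>A B (\<Omega>::config set) (\<phi>::config \<Rightarrow> config).
     is_SFT A \<Omega> \<and> \<Omega> \<noteq> {} \<and> strongly_aperiodic \<Omega> \<and>
     factor_map \<Omega> \<phi> \<and> subshift B (\<phi> ` \<Omega>) \<and>
     strongly_aperiodic (\<phi> ` \<Omega>) \<and> minimal_subshift B (\<phi> ` \<Omega>) \<and>
     (\<forall>\<omega>\<in>\<phi> ` \<Omega>. finite {\<eta>\<in>\<Omega>. \<phi> \<eta> = \<omega>} \<and> card {\<eta>\<in>\<Omega>. \<phi> \<eta> = \<omega>} \<le> 2) \<and>
     (\<exists>D. D \<subseteq> \<phi> ` \<Omega> \<and> \<phi> ` \<Omega> \<subseteq> closure D \<and>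
          (\<forall>\<omega>\<in>D. card {\<eta>\<in>\<Omega>. \<phi> \<eta> = \<omega>} = 1))"
proof -
  have "coprime CHAR(eleven mod_ring) CHAR(thirteen mod_ring)"
    by (simp add: CARD_eleven CARD_thirteen coprime_iff_gcd_eq_1 gcd_non_0_nat)
  from minimal_aperiodic_SFT[OF this] obtain A \<Omega> where
    \<Omega>: "is_SFT A \<Omega>" "minimal_subshift A \<Omega>" "strongly_aperiodic \<Omega>" by blast
  then have sub: "subshift A \<Omega>" by (simp add: minimal_subshift_def)
  have single: "{\<eta>\<in>\<Omega>. id \<eta> = \<omega>} = {\<omega>}" if "\<omega> \<in> \<Omega>" for \<omega>
    using that by auto
  have "factor_map \<Omega> id" by (simp add: factor_map_def)
  moreover have "\<Omega> \<noteq> {}" using sub by (simp add: subshift_def)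
  moreover have "\<exists>D. D \<subseteq> \<Omega> \<and> \<Omega> \<subseteq> closure D \<and> (\<forall>\<omega>\<in>D. card {\<eta>\<in>\<Omega>. id \<eta> = \<omega>} = 1)"
    using single closure_subset by (intro exI[of _ \<Omega>]) simp
  ultimately show ?thesis
    using \<Omega> sub single by (intro exI[of _ A] exI[of _ \<Omega>] exI[of _ id]) simp
qed

end
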